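(* Let $\mu_{1},\mu_{2}\in\mathcal{P}_{\mathbb{T}}^{*}$ be two nondegenerate measures such that $\mu_{2}$ is $\boxtimes$-infinitely divisible, let \[ \Phi(z)=\gamma z\exp\left[\int_{\mathbb{T}}\frac{t+z}{t-z}\,d\sigma(t)\right],\quad z\in\mathbb{D}, \] be an analytic continuation of $\eta_{\mu_{2}}^{\langle-1\rangle}$, where $\gamma\in\mathbb{T}$ and $\sigma$ is a finite positive Borel measure on $\mathbb{T}$, and assume that $\int_{\mathbb{T}}t\,d\sigma(t)\neq0$. Let $\rho_1\in\mathcal{P}_{\mathbb{T}}^*$ be the measure satisfying $\eta_{\mu_1\boxtimes\mu_2}=\eta_{\mu_1}\circ\eta_{\rho_1}$, and let $p_{\mu_1\boxtimes\mu_2}$ be the density of $\mu_1\boxtimes\mu_2$ relative to arclength measure on $\mathbb{T}$. Suppose that $\Gamma\subset\mathbb{T}$ is an open arc with an endpoint $\xi_{0}$, that $p_{\mu_{1}\boxtimes\mu_{2}}(\xi_{0})=0<p_{\mu_{1}\boxtimes\mu_{2}}(\xi)$ for every $\xi\in\Gamma$, and that $1/\eta_{\rho_{1}}(\overline{\xi_{0}})$ is not an atom of $\mu_{1}$. Then $p_{\mu_{1}\boxtimes\mu_{2}}(\xi)/|\xi-\xi_{0}|^{1/3}$ is bounded for $\xi\in\Gamma$ close to $\xi_{0}$.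
   Context: $\mathbb{T}$ is the unit circle, $\mathbb{D}$ the open unit disk, $\mathcal{P}_{\mathbb{T}}$ the set of Borel probability measures on $\mathbb{T}$, and $\mathcal{P}_{\mathbb{T}}^{*}$ the set of those $\mu\in\mathcal{P}_{\mathbb{T}}$ with $\int_{\mathbb{T}}t\,d\mu(t)\neq0$; nondegenerate means not a point mass. For $\mu\in\mathcal{P}_{\mathbb{T}}$ put $\psi_{\mu}(z)=\int_{\mathbb{T}}\frac{tz}{1-tz}\,d\mu(t)$ and $\eta_{\mu}(z)=\frac{\psi_{\mu}(z)}{1+\psi_{\mu}(z)}$, $z\in\mathbb{D}$. For $\mu\in\mathcal{P}_{\mathbb{T}}^{*}$, $\eta_\mu$ has an analytic inverse $\eta_{\mu}^{\langle-1\rangle}$ near $0$; for $\mu_1,\mu_2\in\mathcal{P}_{\mathbb{T}}^{*}$ the free multiplicative convolution $\mu=\mu_1\boxtimes\mu_2\in\mathcal{P}_{\mathbb{T}}^{*}$ is determined by $z\eta_{\mu}^{\langle-1\rangle}(z)=\eta_{\mu_{1}}^{\langle-1\rangle}(z)\eta_{\mu_{2}}^{\langle-1\rangle}(z)$ near $0$. A measure $\mu\in\mathcal{P}_{\mathbb{T}}^*$ is $\boxtimes$-infinitely divisible (an $n$-fold $\boxtimes$-power for every $n$) precisely when $\eta_\mu^{\langle-1\rangle}$ has an analytic continuation to $\mathbb{D}$ of the form $\gamma z\exp\left[\int_{\mathbb{T}}\frac{t+z}{t-z}\,d\sigma(t)\right]$ with $\gamma\in\mathbb{T}$ and $\sigma$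 a finite positive Borel measure on $\mathbb{T}$. The measure $\rho_1$ exists, is unique and is $\boxtimes$-infinitely divisible; $\eta_{\rho_1}^{\langle-1\rangle}$ has the analytic continuation $\Psi(z)=\gamma z\exp\left[\int_{\mathbb{T}}\frac{t+\eta_{\mu_1}(z)}{t-\eta_{\mu_1}(z)}\,d\sigma(t)\right]$, $z\in\mathbb{D}$. The map $\eta_{\rho_1}$ extends to a homeomorphism of $\overline{\mathbb{D}}$ onto $\overline{\eta_{\rho_1}(\mathbb{D})}$, and $\eta_{\mu_1}$ extends continuously to $\overline{\eta_{\rho_1}(\mathbb{D})}$. The density is understood as $p_{\mu_1\boxtimes\mu_2}(\xi)=\frac1{2\pi}\Re\frac{1+\eta_{\mu_1}(\eta_{\rho_1}(\overline{\xi}))}{1-\eta_{\mu_1}(\eta_{\rho_1}(\overline{\xi}))}$ if $|\eta_{\rho_1}(\overline{\xi})|<1$, and $p_{\mu_1\boxtimes\mu_2}(\xi)=0$ if $|\eta_{\rho_1}(\overline{\xi})|=1$, for $\xi\in\mathbb{T}$. *)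

theory Defs
  imports "HOL-Probability.Probability" "HOL-Complex_Analysis.Complex_Analysis"
begin

abbreviation circle_borel :: "complex measure" where
  "circle_borel \<equiv> restrict_space borel (sphere 0 1)"

definition finite_circle_measures :: "complex measure set" where
  "finite_circle_measures = {\<sigma>. finite_measure \<sigma> \<and> sets \<sigma> = sets circle_borel}"

definition prob_circle :: "complex measure set" where
  "prob_circle = {\<mu>. prob_space \<mu> \<and> sets \<mu> = sets circle_borel}"

definition prob_circle_star :: "complex measure set" where
  "prob_circle_star = {\<mu> \<in> prob_circle. (LINT t|\<mu>. t) \<noteq> 0}"

definition nondegenerate :: "complex measure \<Rightarrow> bool" where
  "nondegenerate \<mu> \<longleftrightarrow> \<not> (\<exists>a\<in>sphere 0 1. \<mu> = return circle_borel a)"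

text \<open>The functions \<open>psi \<mu>\<close> and \<open>eta \<mu>\<close> are only meaningful on the open unit disk
  \<open>ball 0 1\<close>; values elsewhere are never used.\<close>

definition psi :: "complex measure \<Rightarrow> complex \<Rightarrow> complex" where
  "psi \<mu> z = (LINT t|\<mu>. t * z / (1 - t * z))"

definition eta :: "complex measure \<Rightarrow> complex \<Rightarrow> complex" where
  "eta \<mu> z = psi \<mu> z / (1 + psi \<mu> z)"

text \<open>For \<open>\<mu> \<in> prob_circle_star\<close> we have \<open>eta \<mu> 0 = 0\<close> and \<open>eta \<mu>\<close> has nonzero derivative
  \<open>LINT t|\<mu>. t\<close> at \<open>0\<close>, so \<open>eta \<mu>\<close> has an analytic inverse near \<open>0\<close> and its germ at \<open>0\<close> is unique.
  Below, \<open>eta_inv \<mu>\<close> is used only up to equality near \<open>0\<close>, so the choice of representative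
  is irrelevant.\<close>

definition is_local_inverse_at_0 :: "(complex \<Rightarrow> complex) \<Rightarrow> (complex \<Rightarrow> complex) \<Rightarrow> bool" where
  "is_local_inverse_at_0 f g \<longleftrightarrow>
     g analytic_on {0} \<and> g 0 = 0 \<and> (\<forall>\<^sub>F z in nhds 0. f (g z) = z \<and> g (f z) = z)"

definition eta_inv :: "complex measure \<Rightarrow> complex \<Rightarrow> complex" where
  "eta_inv \<mu> = (SOME g. is_local_inverse_at_0 (eta \<mu>) g)"

text \<open>\<open>is_free_mult_conv \<mu>\<^sub>1 \<mu>\<^sub>2 \<mu>\<close> states that \<open>\<mu>\<close> is the free multiplicative convolution of
  \<open>\<mu>\<^sub>1\<close> and \<open>\<mu>\<^sub>2\<close>. The convolution is rendered as the graph of the operation,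
  since the equation near \<open>0\<close> determines \<open>\<mu>\<close>.\<close>

definition is_free_mult_conv ::
  "complex measure \<Rightarrow> complex measure \<Rightarrow> complex measure \<Rightarrow> bool" where
  "is_free_mult_conv \<mu>\<^sub>1 \<mu>\<^sub>2 \<mu> \<longleftrightarrow>
     \<mu>\<^sub>1 \<in> prob_circle_star \<and> \<mu>\<^sub>2 \<in> prob_circle_star \<and> \<mu> \<in> prob_circle_star \<and>
     (\<forall>\<^sub>F z in nhds 0. z * eta_inv \<mu> z = eta_inv \<mu>\<^sub>1 z * eta_inv \<mu>\<^sub>2 z)"

text \<open>\<open>is_free_mult_power \<nu> n \<mu>\<close> states that \<open>\<mu>\<close> is the \<open>n\<close>-fold free multiplicative convolution
  power of \<open>\<nu>\<close>, where \<open>n \<ge> 1\<close>.\<close>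

inductive is_free_mult_power :: "complex measure \<Rightarrow> nat \<Rightarrow> complex measure \<Rightarrow> bool"
  for \<nu> :: "complex measure" where
  one: "\<nu> \<in> prob_circle_star \<Longrightarrow> is_free_mult_power \<nu> 1 \<nu>"
| step: "is_free_mult_power \<nu> n \<kappa> \<Longrightarrow> is_free_mult_conv \<kappa> \<nu> \<mu>
    \<Longrightarrow> is_free_mult_power \<nu> (Suc n) \<mu>"

definition free_mult_inf_divisible :: "complex measure \<Rightarrow> bool" where
  "free_mult_inf_divisible \<mu> \<longleftrightarrow>
     \<mu> \<in> prob_circle_star \<and> (\<forall>n\<ge>1. \<exists>\<nu>. is_free_mult_power \<nu> n \<mu>)"

text \<open>The continuous extension to the closed unit disk of a function \<open>f\<close> on the open disk
  (meaningful at boundary points where the limit exists).\<close>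

definition disk_ext :: "(complex \<Rightarrow> complex) \<Rightarrow> complex \<Rightarrow> complex" where
  "disk_ext f z = (if norm z < 1 then f z else Lim (at z within ball 0 1) f)"

text \<open>The density, relative to arclength on the unit circle, of the measure whose eta function is
  \<open>eta \<mu>\<^sub>1 \<circ> eta \<rho>\<^sub>1\<close>. In the first case \<open>eta \<mu>\<^sub>1\<close> is evaluated inside the open disk, so no
  boundary extension of \<open>eta \<mu>\<^sub>1\<close> is needed.\<close>

definition conv_density :: "complex measure \<Rightarrow> complex measure \<Rightarrow> complex \<Rightarrow> real" where
  "conv_density \<mu>\<^sub>1 \<rho>\<^sub>1 \<xi> =
     (let w = disk_ext (eta \<rho>\<^sub>1) (cnj \<xi>) in
      if norm w < 1 then Re ((1 + eta \<mu>\<^sub>1 w) / (1 - eta \<mu>\<^sub>1 w)) / (2 * pi) else 0)"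

text \<open>Open arcs of the unit circle with a given endpoint. The circle minus one point is
  allowed as an open arc; the full circle is not.\<close>

definition open_arc_with_endpoint :: "complex set \<Rightarrow> complex \<Rightarrow> bool" where
  "open_arc_with_endpoint \<Gamma> \<xi>\<^sub>0 \<longleftrightarrow>
     (\<exists>a b. a < b \<and> b \<le> a + 2 * pi \<and> \<Gamma> = cis ` {a<..<b} \<and> (\<xi>\<^sub>0 = cis a \<or> \<xi>\<^sub>0 = cis b))"

end

theory Submission
  imports Defs
begin

text \<open>
  Write \<open>\<omega> = eta \<rho>\<^sub>1\<close> and \<open>u z = \<integral> (t + eta \<mu>\<^sub>1 z) / (t - eta \<mu>\<^sub>1 z) d\<sigma>(t)\<close>. Subordination gives
  \<open>\<gamma> * \<omega> z * exp (u (\<omega> z)) = z\<close> on the disk. With \<open>w = \<omega> z\<close>, \<open>x = - ln \<bar>w\<bar>\<close> and \<open>y = - ln \<bar>z\<bar>\<close>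
  this means \<open>Re (u w) = x - y\<close>, and differentiating gives \<open>z * \<omega>' z * (1 + w * u' w) = w\<close>. The
  Schwarz-Pick bound \<open>\<bar>u' w\<bar> \<le> 2 * Re (u w) / (1 - \<bar>w\<bar>\<^sup>2)\<close> yields
  \<open>\<bar>1 + w * u' w\<bar> \<ge> 1 - (x - y) / sinh x\<close>, which is at least a multiple of \<open>x\<^sup>2 + y / x\<close> and hence
  of \<open>y powr (2/3)\<close>. By Hardy and Littlewood \<open>\<omega>\<close> is then Hoelder continuous with exponent \<open>1/3\<close>
  on the closed disk.

  The density at \<open>\<xi>\<close> is \<open>(1 - \<bar>w\<bar>\<^sup>2) * Q w / (2 * pi)\<close> with \<open>w = \<omega> (cnj \<xi>)\<close> and
  \<open>Q w = \<integral> 1 / \<bar>1 - t * w\<bar>\<^sup>2 d\<mu>\<^sub>1(t)\<close>. Since \<open>\<bar>\<omega> (cnj \<xi>\<^sub>0)\<bar> = 1\<close>, the first factor is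
  \<open>O(\<bar>\<xi> - \<xi>\<^sub>0\<bar> powr (1/3))\<close>; the second one stays bounded because there is no atom at
  \<open>1 / \<omega> (cnj \<xi>\<^sub>0)\<close>.
\<close>

subsection \<open>Cauchy transforms on the circle\<close>

text \<open>The phase \<open>g\<close> lets one set of estimates serve both integrals:
  \<open>g t = t\<close> gives the kernel of \<open>psi\<close>, and \<open>g = cnj\<close> gives
  the Herglotz kernel of \<open>\<sigma>\<close>, because \<open>1 / t = cnj t\<close> on the
  circle.\<close>

locale circle_kernel = finite_measure M for M :: "complex measure" +
  fixes g :: "complex \<Rightarrow> complex"
  assumes g_measurable [measurable]: "g \<in> borel_measurable M"
    and norm_g: "t \<in> space M \<Longrightarrow> norm (g t) = 1"
begin

definition K :: "complex \<Rightarrow> complex" where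
  "K z = (LINT t|M. 1 / (1 - g t * z))"

text \<open>Times \<open>1 - (norm z)^2\<close> this is the Poisson integral of the image of
  \<open>M\<close> under \<open>t \<mapsto> cnj (g t)\<close>. It also dominates the derivative of
  \<open>K\<close>, and this double role produces the Schwarz-Pick estimates below.\<close>

definition Q :: "complex \<Rightarrow> real" where
  "Q z = (LINT t|M. 1 / (norm (1 - g t * z))\<^sup>2)"

definition K' :: "complex \<Rightarrow> complex" where
  "K' z = (LINT t|M. g t / (1 - g t * z)\<^sup>2)"

lemma denominator_lower: "t \<in> space M \<Longrightarrow> 1 - norm z \<le> norm (1 - g t * z)"
  using norm_triangle_ineq2[of 1 "g t * z"] by (simp add: norm_mult norm_g)

lemma denominator_upper: "t \<in> space M \<Longrightarrow> norm (1 - g t * z) \<le> 1 + norm z"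
  using norm_triangle_ineq4[of 1 "g t * z"] by (simp add: norm_mult norm_g)

lemma denominator_nonzero: "t \<in> space M \<Longrightarrow> norm z < 1 \<Longrightarrow> 1 - g t * z \<noteq> 0"
  using denominator_lower[of t z] by auto

lemma integrable_bounded:
  fixes f :: "complex \<Rightarrow> 'b::{banach, second_countable_topology}"
  assumes "f \<in> borel_measurable M" "\<And>t. t \<in> space M \<Longrightarrow> norm (f t) \<le> B"
  shows "integrable M f"
  using assms by (intro integrable_const_bound[where B = B]) auto

lemma integrable_K: "norm z < 1 \<Longrightarrow> integrable M (\<lambda>t. 1 / (1 - g t * z))"
  using denominator_lower[of _ z] denominator_nonzero[of _ z]
  by (intro integrable_bounded[where B = "1 / (1 - norm z)"])
     (auto simp: norm_divide intro!: frac_le)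

lemma integrable_K':
  assumes "norm z < 1"
  shows "integrable M (\<lambda>t. g t / (1 - g t * z)\<^sup>2)"
  using assms denominator_lower[of _ z] denominator_nonzero[of _ z]
  by (intro integrable_bounded[where B = "1 / (1 - norm z)\<^sup>2"])
     (auto simp: norm_divide norm_power norm_g intro!: frac_le power_mono)

lemma integrable_Q:
  assumes "norm z < 1"
  shows "integrable M (\<lambda>t. 1 / (norm (1 - g t * z))\<^sup>2)"
  using assms denominator_lower[of _ z] denominator_nonzero[of _ z]
  by (intro integrable_bounded[where B = "1 / (1 - norm z)\<^sup>2"])
     (auto simp: norm_divide norm_power norm_g intro!: frac_le power_mono)

lemma norm_K'_le: "norm z < 1 \<Longrightarrow> norm (K' z) \<le> Q z"
  unfolding K'_def Q_def
  by (intro Bochner_Integration.integral_norm_bound_integral integrable_K' integrable_Q)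
     (auto simp: norm_divide norm_power norm_g)

text \<open>The error of the difference quotient is an explicit integral. Its denominator consists
  of two factors of size at least \<open>d\<close> and one of size at least \<open>d / 2\<close>, so
  the error is linear in \<open>h\<close>.\<close>

lemma K_has_field_derivative:
  assumes z: "norm z < 1"
  shows "(K has_field_derivative K' z) (at z)"
proof -
  define d where "d = 1 - norm z"
  have d: "d > 0" using z by (simp add: d_def)
  have bound: "norm ((K (z + h) - K z) / h - K' z) \<le> (2 / d ^ 3 * measure M (space M)) * norm h"
    if h: "h \<noteq> 0" "norm h < d / 2" for h
  proof -
    have zh: "norm (z + h) < 1" "1 - norm (z + h) \<ge> d / 2"
      using norm_triangle_ineq[of z h] h d by (auto simp: d_def)
    have "(K (z + h) - K z) / h - K' z =
        (LINT t|M. (1 / (1 - g t * (z + h)) - 1 / (1 - g t * z)) / h - g t / (1 - g t * z)\<^sup>2)"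
      unfolding K_def K'_def using integrable_K[OF z] integrable_K[OF zh(1)] integrable_K'[OF z]
      by simp
    also have "\<dots> = (LINT t|M. h * (g t)\<^sup>2 / ((1 - g t * z)\<^sup>2 * (1 - g t * (z + h))))"
    proof (rule Bochner_Integration.integral_cong[OF refl])
      fix t assume t: "t \<in> space M"
      have "1 - g t * z \<noteq> 0" "1 - g t * (z + h) \<noteq> 0"
        using t z zh denominator_nonzero by blast+
      then show "(1 / (1 - g t * (z + h)) - 1 / (1 - g t * z)) / h - g t / (1 - g t * z)\<^sup>2 =
          h * (g t)\<^sup>2 / ((1 - g t * z)\<^sup>2 * (1 - g t * (z + h)))"
        using h(1) by (simp add: divide_simps) (simp add: algebra_simps power2_eq_square)
    qed
    also have "norm \<dots> \<le> (LINT t|M. norm h * (2 / d ^ 3))"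
    proof -
      have le: "norm (h * (g t)\<^sup>2 / ((1 - g t * z)\<^sup>2 * (1 - g t * (z + h)))) \<le> norm h * (2 / d ^ 3)"
        if t: "t \<in> space M" for t
      proof -
        have "d\<^sup>2 * (d / 2) \<le> (norm (1 - g t * z))\<^sup>2 * norm (1 - g t * (z + h))"
          using denominator_lower[OF t, of z] denominator_lower[OF t, of "z + h"] zh d
          by (intro mult_mono power_mono) (auto simp: d_def)
        moreover have "0 < d\<^sup>2 * (d / 2)" using d by simp
        ultimately have "norm h / ((norm (1 - g t * z))\<^sup>2 * norm (1 - g t * (z + h))) \<le> norm h / (d\<^sup>2 * (d / 2))"
          by (intro divide_left_mono) (auto intro!: mult_pos_pos dest: less_le_trans)
        then show ?thesis
          using t by (simp add: norm_mult norm_divide norm_power norm_g power3_eq_cube power2_eq_square)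
      qed
      show ?thesis
        by (intro Bochner_Integration.integral_norm_bound_integral le integrable_bounded[OF _ le]) auto
    qed
    finally show ?thesis by (simp add: mult_ac)
  qed
  have "((\<lambda>h. (K (z + h) - K z) / h - K' z) \<longlongrightarrow> 0) (at 0)"
  proof (rule Lim_null_comparison)
    show "\<forall>\<^sub>F h in at 0. norm ((K (z + h) - K z) / h - K' z) \<le> (2 / d ^ 3 * measure M (space M)) * norm h"
      unfolding eventually_at using d bound by (intro exI[of _ "d / 2"]) auto
    show "((\<lambda>h. 2 / d ^ 3 * measure M (space M) * norm h) \<longlongrightarrow> 0) (at 0)"
      using d by (auto intro!: tendsto_eq_intros)
  qed
  then show ?thesis
    unfolding DERIV_def by (simp add: Lim_null[symmetric])
qed

text \<open>For \<open>s = g t * z\<close> the integrand is \<open>Re ((1 + s) / (1 - s))\<close>,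
  the Poisson kernel; its numerator depends only on \<open>norm s = norm z\<close> and leaves the
  integral.\<close>

lemma Re_K:
  assumes z: "norm z < 1"
  shows "2 * Re (K z) - measure M (space M) = (1 - (norm z)\<^sup>2) * Q z"
proof -
  have "2 * Re (K z) - measure M (space M) = (LINT t|M. 2 * Re (1 / (1 - g t * z)) - 1)"
    unfolding K_def using integrable_K[OF z] by (simp add: integral_Re)
  also have "\<dots> = (LINT t|M. (1 - (norm z)\<^sup>2) * (1 / (norm (1 - g t * z))\<^sup>2))"
  proof (rule Bochner_Integration.integral_cong[OF refl])
    fix t assume t: "t \<in> space M"
    define s where "s = g t * z"
    have s: "norm s = norm z" using t by (simp add: s_def norm_mult norm_g)
    have nz: "(norm (1 - s))\<^sup>2 \<noteq> 0"
      using denominator_nonzero[OF t z] by (simp add: s_def)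
    have "2 * Re (1 / (1 - s)) - 1 = (1 - (norm s)\<^sup>2) / (norm (1 - s))\<^sup>2"
      using nz unfolding cmod_power2 by (simp add: Re_divide field_simps power2_eq_square)
    then show "2 * Re (1 / (1 - g t * z)) - 1 = (1 - (norm z)\<^sup>2) * (1 / (norm (1 - g t * z))\<^sup>2)"
      by (simp only: s) (simp add: s_def)
  qed
  also have "\<dots> = (1 - (norm z)\<^sup>2) * Q z"
    by (simp only: Q_def integral_mult_right_zero)
  finally show ?thesis .
qed

lemma Q_ge:
  assumes z: "norm z < 1"
  shows "measure M (space M) / 4 \<le> Q z"
proof -
  have "(LINT t|M. 1 / 4) \<le> Q z"
    unfolding Q_def
  proof (rule integral_mono)
    fix t assume t: "t \<in> space M"
    have "(norm (1 - g t * z))\<^sup>2 \<le> 2\<^sup>2"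
      using denominator_upper[OF t, of z] z by (intro power_mono) auto
    then show "1 / 4 \<le> 1 / (norm (1 - g t * z))\<^sup>2"
      using denominator_nonzero[OF t z] by (simp add: divide_simps)
  qed (auto intro: integrable_Q[OF z])
  then show ?thesis by simp
qed

end

text \<open>Off \<open>N\<close> the kernel is at most \<open>B\<close>. On \<open>N\<close> its
  modulus \<open>a\<close> satisfies \<open>a \<le> l / 2 + a^2 / (2 * l)\<close>, so a small mass
  of \<open>N\<close> and a bound on \<open>Q\<close> together control \<open>K\<close>. The weight
  \<open>l\<close> is free and is later taken proportional to \<open>norm (K z)\<close>.\<close>

lemma (in circle_kernel) norm_K_le:
  assumes z: "norm z < 1" and N [measurable]: "N \<in> sets M" and l: "l > 0"
    and off: "\<And>t. t \<in> space M - N \<Longrightarrow> norm (1 / (1 - g t * z)) \<le> B" and B: "B \<ge> 0"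
  shows "norm (K z) \<le> B * measure M (space M) + l / 2 * measure M N + Q z / (2 * l)"
proof -
  define P where "P = (\<lambda>t. 1 / (norm (1 - g t * z))\<^sup>2)"
  have P: "integrable M P" "Q z = (LINT t|M. P t)"
    using integrable_Q[OF z] by (simp_all add: P_def Q_def)
  have iN: "integrable M (indicator N :: complex \<Rightarrow> real)"
    by (intro integrable_real_indicator) (auto simp: less_top[symmetric])
  define h where "h = (\<lambda>t. B + (l / 2 * indicator N t + P t / (2 * l)))"
  have ih: "integrable M h"
    unfolding h_def using P(1) iN by simp
  have "norm (K z) \<le> (LINT t|M. h t)"
    unfolding K_def
  proof (rule Bochner_Integration.integral_norm_bound_integral[OF integrable_K[OF z] ih])
    fix t assume t: "t \<in> space M"
    define a where "a = norm (1 / (1 - g t * z))"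
    have a: "a \<ge> 0" "P t = a\<^sup>2"
      by (auto simp: a_def P_def norm_divide power_divide)
    have "a \<le> l / 2 + a\<^sup>2 / (2 * l)"
    proof -
      have "0 \<le> (a - l)\<^sup>2 / (2 * l)" using l by simp
      also have "\<dots> = l / 2 + a\<^sup>2 / (2 * l) - a"
        using l by (simp add: field_simps power2_eq_square)
      finally show ?thesis by simp
    qed
    then show "norm (1 / (1 - g t * z)) \<le> h t"
      unfolding h_def a(2) a_def[symmetric] using off[of t] t l B a
      by (cases "t \<in> N") (auto simp: a_def[symmetric] intro: add_increasing2)
  qed
  also have "\<dots> = B * measure M (space M) + (l / 2 * measure M N + Q z / (2 * l))"
    unfolding h_def P(2) using P(1) iN by simp
  finally show ?thesis by simp
qed

subsection \<open>Hoelder continuity from derivative bounds\<close>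

text \<open>Along the radius the derivative is at most
  \<open>C * (1 - s) powr (\<alpha> - 1)\<close>, with antiderivative \<open>\<phi>\<close>, whose
  values stay finite up to \<open>s = 1\<close> since \<open>\<alpha> > 0\<close>. The bound is
  uniform in \<open>a\<close>.\<close>

lemma radial_increment_le:
  fixes f :: "complex \<Rightarrow> complex"
  assumes f: "f holomorphic_on ball 0 1" and \<alpha>: "0 < \<alpha>" "\<alpha> \<le> 1" and C: "C \<ge> 0"
    and deriv: "\<And>z. norm z < 1 \<Longrightarrow> norm (deriv f z) \<le> C * (1 - norm z) powr (\<alpha> - 1)"
    and a: "norm a < 1" and d: "0 < d" "d \<le> 1"
  shows "norm (f a - f (of_real (1 - d) * a)) \<le> C / \<alpha> * d powr \<alpha>"
proof -
  define \<phi> where "\<phi> = (\<lambda>s::real. - (C / \<alpha>) * (1 - s) powr \<alpha>)"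
  have in_disk: "norm (of_real s * a) \<le> norm a" "norm (of_real s * a) < 1" if "0 \<le> s" "s \<le> 1" for s :: real
    using that a mult_right_mono[of s 1 "norm a"] by (auto simp: norm_mult)
  have f': "(f has_field_derivative deriv f z) (at z)" if "norm z < 1" for z
    using holomorphic_derivI[OF f open_ball, of z UNIV] that by simp
  have "norm (f (of_real 1 * a) - f (of_real (1 - d) * a)) \<le> \<phi> 1 - \<phi> (1 - d)"
  proof (rule differentiable_bound_general)
    show "1 - d < 1" using d by simp
    show "continuous_on {1 - d..1} (\<lambda>s. f (of_real s * a))"
      using d in_disk
      by (intro continuous_on_compose2[OF holomorphic_on_imp_continuous_on[OF f]] continuous_intros)
         auto
    show "continuous_on {1 - d..1} \<phi>"
      unfolding \<phi>_def using \<alpha> d by (intro continuous_intros continuous_on_powr') auto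
  next
    fix s assume s: "1 - d < s" "s < 1"
    show "((\<lambda>s. f (of_real s * a)) has_vector_derivative a * deriv f (of_real s * a)) (at s)"
    proof -
      have "((\<lambda>s. of_real s * a) has_vector_derivative a) (at s)"
        unfolding has_vector_derivative_def
        by (auto intro!: derivative_eq_intros simp: scaleR_conv_of_real)
      moreover have "(f has_field_derivative deriv f (of_real s * a)) (at (of_real s * a))"
        using s d in_disk[of s] by (intro f') auto
      ultimately show ?thesis
        using field_vector_diff_chain_at by (fastforce simp: o_def)
    qed
    show "(\<phi> has_vector_derivative C * (1 - s) powr (\<alpha> - 1)) (at s)"
      unfolding \<phi>_def has_real_derivative_iff_has_vector_derivative[symmetric]
      using s \<alpha> by (auto intro!: derivative_eq_intros)
    have "norm (a * deriv f (of_real s * a)) \<le> 1 * (C * (1 - norm (of_real s * a)) powr (\<alpha> - 1))"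
      unfolding norm_mult[of a] using a s d in_disk[of s] by (intro mult_mono deriv) auto
    also have "\<dots> \<le> 1 * (C * (1 - s) powr (\<alpha> - 1))"
      using s d a C \<alpha> mult_left_mono[of "norm a" 1 s]
      by (intro mult_left_mono powr_mono2') (auto simp: norm_mult)
    finally show "norm (a * deriv f (of_real s * a)) \<le> C * (1 - s) powr (\<alpha> - 1)" by simp
  qed
  then show ?thesis by (simp add: \<phi>_def)
qed

text \<open>Hardy and Littlewood: compare \<open>f a\<close> and \<open>f b\<close> by moving radially inwards to distance
  \<open>norm (a - b)\<close> from the circle, and then along a segment.\<close>

lemma holder_of_deriv_bound:
  fixes f :: "complex \<Rightarrow> complex"
  assumes f: "f holomorphic_on ball 0 1" and \<alpha>: "0 < \<alpha>" "\<alpha> \<le> 1" and C: "C \<ge> 0"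
    and deriv: "\<And>z. norm z < 1 \<Longrightarrow> norm (deriv f z) \<le> C * (1 - norm z) powr (\<alpha> - 1)"
    and a: "norm a < 1" and b: "norm b < 1" and ab: "norm (a - b) \<le> 1"
  shows "norm (f a - f b) \<le> (2 * C / \<alpha> + C) * norm (a - b) powr \<alpha>"
proof (cases "a = b")
  case False
  define d where "d = norm (a - b)"
  have d: "0 < d" "d \<le> 1" using False ab by (auto simp: d_def)
  define r where "r = complex_of_real (1 - d)"
  have r: "norm r = 1 - d" using d unfolding r_def norm_of_real by simp
  \<comment> \<open>Both points lie in the convex disk of radius \<open>1 - d\<close>, where the
    derivative is at most \<open>C * d powr (\<alpha> - 1)\<close>; their distance is at most
    \<open>d\<close>.\<close>
  have "norm (f (r * a) - f (r * b)) \<le> C * d powr (\<alpha> - 1) * norm (r * a - r * b)"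
  proof (rule field_differentiable_bound)
    fix z :: complex assume z: "z \<in> cball 0 (1 - d)"
    show "(f has_field_derivative deriv f z) (at z within cball 0 (1 - d))"
      using holomorphic_derivI[OF f open_ball, of z] z d by auto
    have "norm (deriv f z) \<le> C * (1 - norm z) powr (\<alpha> - 1)"
      using z d by (intro deriv) auto
    also have "\<dots> \<le> C * d powr (\<alpha> - 1)"
      using z d C \<alpha> by (intro mult_left_mono powr_mono2') auto
    finally show "norm (deriv f z) \<le> C * d powr (\<alpha> - 1)" .
  qed (use a b d in \<open>auto simp: norm_mult r intro: mult_left_le\<close>)
  also have "\<dots> \<le> C * d powr (\<alpha> - 1) * d"
  proof (rule mult_left_mono)
    have "norm (r * a - r * b) = (1 - d) * d"
      by (simp only: right_diff_distrib[symmetric] norm_mult r d_def)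
    then show "norm (r * a - r * b) \<le> d"
      using d mult_right_mono[of "1 - d" 1 d] by simp
    show "0 \<le> C * d powr (\<alpha> - 1)" using C by simp
  qed
  also have "\<dots> = C * d powr \<alpha>"
    using d by (simp add: powr_diff)
  finally have "norm (f (r * a) - f (r * b)) \<le> C * d powr \<alpha>" .
  moreover have "norm (f a - f (r * a)) \<le> C / \<alpha> * d powr \<alpha>"
    unfolding r_def by (rule radial_increment_le[OF f \<alpha> C deriv a d])
  moreover have "norm (f b - f (r * b)) \<le> C / \<alpha> * d powr \<alpha>"
    unfolding r_def by (rule radial_increment_le[OF f \<alpha> C deriv b d])
  ultimately have "norm (f a - f b) \<le> C / \<alpha> * d powr \<alpha> + C * d powr \<alpha> + C / \<alpha> * d powr \<alpha>"
    using norm_triangle_ineq[of "f a - f (r * a)" "f (r * a) - f b"]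
      norm_triangle_ineq[of "f (r * a) - f (r * b)" "f (r * b) - f b"]
      norm_minus_commute[of "f b" "f (r * b)"]
    unfolding diff_add_cancel add_diff_eq by linarith
  then show ?thesis by (simp add: d_def algebra_simps)
qed simp

context
  fixes f :: "complex \<Rightarrow> complex" and C \<alpha> :: real
  assumes \<alpha>: "0 < \<alpha>" and C: "C \<ge> 0"
    and holder: "\<And>a b. norm a < 1 \<Longrightarrow> norm b < 1 \<Longrightarrow> norm (a - b) \<le> 1 \<Longrightarrow>
      norm (f a - f b) \<le> C * norm (a - b) powr \<alpha>"
begin

text \<open>The estimate gives uniform continuity, hence a continuous extension to the closed disk,
  so \<open>Lim\<close> in \<open>disk_ext\<close> denotes an actual limit.\<close>

lemma tendsto_disk_ext_of_holder:
  assumes \<zeta>: "norm \<zeta> = 1"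
  shows "(f \<longlongrightarrow> disk_ext f \<zeta>) (at \<zeta> within ball 0 1)"
proof -
  have uc: "uniformly_continuous_on (ball 0 1) f"
    unfolding uniformly_continuous_on_def
  proof (intro allI impI)
    fix e :: real assume e: "e > 0"
    \<comment> \<open>The estimate is available at distances up to 1 only. Dividing by
      \<open>C + 1\<close> covers \<open>C = 0\<close> and makes the final inequality
      strict.\<close>
    define d where "d = min 1 ((e / (C + 1)) powr (1 / \<alpha>))"
    have d: "d > 0" "d \<le> 1" using e C by (auto simp: d_def)
    have "dist (f b) (f a) < e" if "norm a < 1" "norm b < 1" "dist b a < d" for a b
    proof -
      have "dist (f b) (f a) \<le> C * norm (b - a) powr \<alpha>"
        unfolding dist_norm using that d by (intro holder) (auto simp: dist_norm)
      also have "\<dots> \<le> C * (e / (C + 1))"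
      proof (intro mult_left_mono C)
        have "norm (b - a) powr \<alpha> \<le> ((e / (C + 1)) powr (1 / \<alpha>)) powr \<alpha>"
          using that \<alpha> by (intro powr_mono2) (auto simp: d_def dist_norm)
        then show "norm (b - a) powr \<alpha> \<le> e / (C + 1)"
          using e C \<alpha> by (simp add: powr_powr)
      qed
      also have "\<dots> < e" using e C by (simp add: field_simps)
      finally show ?thesis .
    qed
    then show "\<exists>d>0. \<forall>a\<in>ball 0 1. \<forall>b\<in>ball 0 1. dist b a < d \<longrightarrow> dist (f b) (f a) < e"
      using d by (intro exI[of _ d]) auto
  qed
  obtain F where F: "uniformly_continuous_on (closure (ball 0 1)) F"
      "\<And>z. z \<in> ball 0 1 \<Longrightarrow> f z = F z"
    by (rule uniformly_continuous_on_extension_on_closure[OF uc]) (rule that)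
  have "(F \<longlongrightarrow> F \<zeta>) (at \<zeta> within cball 0 1)"
    using uniformly_continuous_imp_continuous[OF F(1)] \<zeta> by (simp add: continuous_on_def)
  then have "(F \<longlongrightarrow> F \<zeta>) (at \<zeta> within ball 0 1)"
    by (rule tendsto_within_subset) auto
  then have lim: "(f \<longlongrightarrow> F \<zeta>) (at \<zeta> within ball 0 1)"
    by (rule Lim_transform_eventually) (simp add: eventually_at_filter F(2))
  moreover have "at \<zeta> within ball 0 1 \<noteq> bot"
    using \<zeta> by (simp add: trivial_limit_within islimpt_ball)
  ultimately show ?thesis
    using tendsto_Lim[of "at \<zeta> within ball 0 1" f "F \<zeta>"] \<zeta> by (simp add: disk_ext_def)
qed

lemma tendsto_radial_disk_ext:
  assumes \<zeta>: "norm \<zeta> = 1"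
  shows "(\<lambda>n. f (of_real (1 - inverse (real (Suc n))) * \<zeta>)) \<longlonglongrightarrow> disk_ext f \<zeta>"
proof -
  define z where "z = (\<lambda>n. of_real (1 - inverse (real (Suc n))) * \<zeta>)"
  have "norm (z n) < 1" for n
  proof -
    have "0 \<le> 1 - inverse (real (Suc n))" "1 - inverse (real (Suc n)) < 1"
      using inverse_le_1_iff[of "real (Suc n)"] by auto
    then show ?thesis
      unfolding z_def norm_mult norm_of_real \<zeta> by (simp only: abs_of_nonneg mult_1_right)
  qed
  then have "\<forall>\<^sub>F n in sequentially. z n \<in> ball 0 1 \<and> z n \<noteq> \<zeta>"
    using \<zeta> by (intro always_eventually) (metis mem_ball_0 order_less_irrefl)
  moreover have "z \<longlonglongrightarrow> of_real (1 - 0) * \<zeta>"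
    unfolding z_def by (intro tendsto_intros LIMSEQ_inverse_real_of_nat)
  ultimately have "filterlim z (at \<zeta> within ball 0 1) sequentially"
    by (simp add: filterlim_at)
  then show ?thesis
    using filterlim_compose[OF tendsto_disk_ext_of_holder[OF \<zeta>]] by (simp add: z_def)
qed

text \<open>Both boundary points are approached radially with the same factor, which does not
  increase their distance, so the interior estimate survives in the limit.\<close>

lemma norm_disk_ext_diff_le:
  assumes "norm \<zeta> = 1" "norm \<xi> = 1" "norm (\<zeta> - \<xi>) \<le> 1"
  shows "norm (disk_ext f \<zeta> - disk_ext f \<xi>) \<le> C * norm (\<zeta> - \<xi>) powr \<alpha>"
proof (rule LIMSEQ_le_const2)
  show "(\<lambda>n. norm (f (of_real (1 - inverse (real (Suc n))) * \<zeta>) - f (of_real (1 - inverse (real (Suc n))) * \<xi>)))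
      \<longlonglongrightarrow> norm (disk_ext f \<zeta> - disk_ext f \<xi>)"
    by (intro tendsto_intros tendsto_radial_disk_ext assms)
  have "norm (f (of_real (1 - inverse (real (Suc n))) * \<zeta>) - f (of_real (1 - inverse (real (Suc n))) * \<xi>))
      \<le> C * norm (\<zeta> - \<xi>) powr \<alpha>" for n
  proof -
    define s where "s = 1 - inverse (real (Suc n))"
    have s: "0 \<le> s" "s < 1" using inverse_le_1_iff[of "real (Suc n)"] by (auto simp: s_def)
    have "norm (of_real s * \<zeta> - of_real s * \<xi>) = s * norm (\<zeta> - \<xi>)"
      using s by (simp add: right_diff_distrib[symmetric] norm_mult)
    moreover have "s * norm (\<zeta> - \<xi>) \<le> norm (\<zeta> - \<xi>)"
      using s by (simp add: mult_left_le_one_le)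
    ultimately have le: "norm (of_real s * \<zeta> - of_real s * \<xi>) \<le> norm (\<zeta> - \<xi>)" by simp
    have "norm (f (of_real s * \<zeta>) - f (of_real s * \<xi>)) \<le> C * norm (of_real s * \<zeta> - of_real s * \<xi>) powr \<alpha>"
      using s assms le by (intro holder) (auto simp: norm_mult)
    also have "\<dots> \<le> C * norm (\<zeta> - \<xi>) powr \<alpha>"
      using le C \<alpha> by (intro mult_left_mono powr_mono2) auto
    finally show ?thesis unfolding s_def .
  qed
  then show "\<exists>N. \<forall>n\<ge>N. norm (f (of_real (1 - inverse (real (Suc n))) * \<zeta>) -
      f (of_real (1 - inverse (real (Suc n))) * \<xi>)) \<le> C * norm (\<zeta> - \<xi>) powr \<alpha>" by blast
qed

end

subsection \<open>A lower bound for the hyperbolic sine\<close>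

text \<open>The derivative of the difference is \<open>2 * (sinh (y / 2))^2 - y^2 / 2\<close>, which
  is nonnegative because \<open>sinh (y / 2) \<ge> y / 2\<close>.\<close>

lemma sinh_ge_cubic:
  fixes x :: real
  assumes "0 \<le> x"
  shows "x + x ^ 3 / 6 \<le> sinh x"
proof -
  have "sinh 0 - 0 - 0 ^ 3 / 6 \<le> sinh x - x - x ^ 3 / 6"
  proof (rule DERIV_nonneg_imp_nondecreasing[OF assms])
    fix y :: real assume y: "0 \<le> y"
    have "y / 2 \<le> sinh (y / 2)"
      using real_le_x_sinh[of "y / 2"] y by (simp add: sinh_def exp_minus)
    then have "(y / 2)\<^sup>2 \<le> (sinh (y / 2))\<^sup>2" using y by (intro power_mono) auto
    moreover have "cosh y = 1 + 2 * (sinh (y / 2))\<^sup>2"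
      using cosh_double[of "y / 2"] cosh_square_eq[of "y / 2"] by simp
    ultimately have "0 \<le> cosh y - 1 - y\<^sup>2 / 2" by (simp add: power_divide)
    moreover have "((\<lambda>y. sinh y - y - y ^ 3 / 6) has_real_derivative cosh y - 1 - y\<^sup>2 / 2) (at y)"
      by (auto intro!: derivative_eq_intros)
    ultimately show "\<exists>D. ((\<lambda>y. sinh y - y - y ^ 3 / 6) has_real_derivative D) (at y) \<and> 0 \<le> D"
      by blast
  qed
  then show ?thesis by simp
qed

text \<open>The gap between \<open>x\<close> and \<open>sinh x\<close> is cubic; this is the origin of the exponent \<open>1/3\<close>.\<close>

lemma one_minus_div_sinh_ge:
  fixes x y X :: real
  assumes y: "0 < y" "y \<le> x" and X: "x \<le> X"
  shows "y powr (2 / 3) / (6 + X\<^sup>2) \<le> 1 - (x - y) / sinh x"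
proof -
  have x: "0 < x" using y by simp
  \<comment> \<open>The terms \<open>x^2\<close> and \<open>6 * y / x\<close> balance when
    \<open>x\<close> is of the order of this cube root: the first exceeds \<open>s^2\<close> if
    \<open>s \<le> x\<close>, the second otherwise.\<close>
  define s where "s = y powr (1 / 3)"
  have s: "0 < s" "s ^ 3 = y" "s\<^sup>2 = y powr (2 / 3)"
    using y by (auto simp: s_def powr_realpow[symmetric] powr_powr)
  have "s\<^sup>2 \<le> x\<^sup>2 + 6 * s ^ 3 / x"
  proof (cases "s \<le> x")
    case True
    then have "s\<^sup>2 \<le> x\<^sup>2" using s by (intro power_mono) auto
    then show ?thesis using s(1) x by (intro order_trans[OF _ le_add_same_cancel1[THEN iffD2]]) auto
  next
    case False
    then have "s\<^sup>2 * x \<le> s\<^sup>2 * s" by (intro mult_left_mono) auto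
    also have "\<dots> \<le> 6 * s ^ 3" using s(1) by (simp add: power2_eq_square power3_eq_cube)
    finally have "s\<^sup>2 \<le> 6 * s ^ 3 / x" using x by (simp add: field_simps)
    then show ?thesis by (simp add: add_increasing)
  qed
  then have "s\<^sup>2 / (6 + X\<^sup>2) \<le> (x\<^sup>2 + 6 * y / x) / (6 + X\<^sup>2)"
    using s by (intro divide_right_mono) auto
  also have "\<dots> \<le> (x\<^sup>2 + 6 * y / x) / (6 + x\<^sup>2)"
    using x y X power_mono[of x X 2] by (intro divide_left_mono) (auto intro!: mult_pos_pos add_pos_nonneg)
  \<comment> \<open>The quotient is exactly what the cubic lower bound for \<open>sinh x\<close>
    produces; since \<open>x - y \<ge> 0\<close>, passing to \<open>sinh x\<close> only increases
    the right side.\<close>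
  also have "\<dots> = 1 - (x - y) / (x + x ^ 3 / 6)"
  proof -
    have pos: "0 < 6 + x\<^sup>2" using x by (simp add: add_pos_pos)
    have eq: "x + x ^ 3 / 6 = x * (6 + x\<^sup>2) / 6"
      by (simp add: field_simps power2_eq_square power3_eq_cube)
    show ?thesis
      unfolding eq using x pos by (simp add: divide_simps) (simp add: algebra_simps power2_eq_square)
  qed
  also have "\<dots> \<le> 1 - (x - y) / sinh x"
    using sinh_ge_cubic[of x] x y by (intro diff_left_mono divide_left_mono) (auto intro!: mult_pos_pos add_pos_pos)
  finally show ?thesis by (simp add: s)
qed

lemma one_minus_norm_sq_pos: "norm (z::complex) < 1 \<Longrightarrow> 0 < 1 - (norm z)\<^sup>2"
  using power_strict_mono[of "norm z" 1 2] by simp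

lemma circle_kernelI:
  assumes "finite_measure M" and sets: "sets M = sets circle_borel"
    and g: "g \<in> borel_measurable borel" "\<And>t. norm t = 1 \<Longrightarrow> norm (g t) = 1"
  shows "circle_kernel M g"
proof -
  interpret finite_measure M by fact
  have "space M = sphere 0 1"
    using sets_eq_imp_space_eq[OF sets] by (simp add: space_restrict_space)
  moreover have "g \<in> borel_measurable M"
    using g(1) by (subst measurable_cong_sets[OF sets refl]) (rule measurable_restrict_space1)
  ultimately show ?thesis
    by unfold_locales (use g(2) in auto)
qed

subsection \<open>The eta transform\<close>

locale circle_prob = prob_space M for M :: "complex measure" +
  assumes sets_M: "sets M = sets circle_borel"

sublocale circle_prob \<subseteq> circle_kernel M "\<lambda>t. t"
  by (rule circle_kernelI[OF finite_measure_axioms sets_M]) auto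

context circle_prob
begin

lemma Re_K_prob: "norm z < 1 \<Longrightarrow> 2 * Re (K z) - 1 = (1 - (norm z)\<^sup>2) * Q z"
  using Re_K[of z] by (simp add: prob_space)

text \<open>The map \<open>k \<mapsto> 1 - 1 / k\<close> sends this half-plane into the unit disk,
  which is why \<open>eta M\<close> is a self-map of the disk.\<close>

lemma Re_K_gt: "norm z < 1 \<Longrightarrow> 1 / 2 < Re (K z)"
  using Re_K_prob[of z] Q_ge[of z] one_minus_norm_sq_pos[of z] mult_pos_pos[of "1 - (norm z)\<^sup>2" "Q z"]
  unfolding prob_space by linarith

lemma K_nonzero: "norm z < 1 \<Longrightarrow> K z \<noteq> 0"
  using Re_K_gt[of z] by auto

lemma psi_eq: "norm z < 1 \<Longrightarrow> psi M z = K z - 1"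
proof -
  assume z: "norm z < 1"
  have "psi M z = (LINT t|M. 1 / (1 - t * z) - 1)"
    unfolding psi_def
    by (rule Bochner_Integration.integral_cong[OF refl])
       (use denominator_nonzero[OF _ z] in \<open>auto simp: field_simps\<close>)
  then show ?thesis
    using integrable_K[OF z] by (simp add: K_def prob_space)
qed

lemma eta_eq: "norm z < 1 \<Longrightarrow> eta M z = 1 - 1 / K z"
  using K_nonzero[of z] by (simp add: eta_def psi_eq field_simps)

lemma eta_0 [simp]: "eta M 0 = 0"
  by (simp add: eta_eq K_def prob_space)

text \<open>Since \<open>eta M z = (K z - 1) / K z\<close>, the numerator is
  \<open>2 * Re (K z) - 1\<close>, a Poisson integral. As an equality it serves in both directions:
  for Schwarz-Pick, and later to bound \<open>Q\<close> by a multiple of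
  \<open>(norm (K z))^2\<close>.\<close>

lemma one_minus_norm_eta_sq:
  assumes z: "norm z < 1"
  shows "1 - (norm (eta M z))\<^sup>2 = (1 - (norm z)\<^sup>2) * Q z / (norm (K z))\<^sup>2"
proof -
  have "(norm (eta M z))\<^sup>2 = (norm (K z - 1))\<^sup>2 / (norm (K z))\<^sup>2"
    using K_nonzero[OF z] by (simp add: eta_eq[OF z] field_simps norm_divide power_divide flip: power_mult_distrib)
  moreover have "(norm (K z - 1))\<^sup>2 = (norm (K z))\<^sup>2 - (2 * Re (K z) - 1)"
    unfolding cmod_power2 by (simp add: power2_eq_square algebra_simps)
  ultimately show ?thesis
    unfolding Re_K_prob[OF z, symmetric] using K_nonzero[OF z] by (simp add: field_simps)
qed

lemma norm_eta_less: "norm z < 1 \<Longrightarrow> norm (eta M z) < 1"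
proof -
  assume z: "norm z < 1"
  have "0 < 1 - (norm (eta M z))\<^sup>2"
    unfolding one_minus_norm_eta_sq[OF z] using Re_K_gt[OF z] Re_K_prob[OF z] K_nonzero[OF z]
    by (intro divide_pos_pos) auto
  then show ?thesis using power_mono[of 1 "norm (eta M z)" 2] by fastforce
qed

lemma eta_has_field_derivative:
  assumes z: "norm z < 1"
  shows "(eta M has_field_derivative K' z / (K z)\<^sup>2) (at z)"
proof -
  have "((\<lambda>z. 1 - 1 / K z) has_field_derivative K' z / (K z)\<^sup>2) (at z)"
    using K_has_field_derivative[OF z] K_nonzero[OF z]
    by (auto intro!: derivative_eq_intros simp: power2_eq_square)
  then show ?thesis
    by (rule has_field_derivative_transform_within_open[where S = "ball 0 1"])
       (use z in \<open>auto simp: eta_eq\<close>)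
qed

lemma eta_holomorphic: "eta M holomorphic_on ball 0 1"
  using eta_has_field_derivative by (force simp: holomorphic_on_open)

text \<open>Schwarz-Pick for \<open>eta M\<close>: the right side is exactly
  \<open>Q z / (norm (K z))^2\<close>, and \<open>Q\<close> dominates \<open>K'\<close>.\<close>

lemma norm_deriv_eta_le:
  assumes z: "norm z < 1"
  shows "norm (K' z / (K z)\<^sup>2) \<le> (1 - (norm (eta M z))\<^sup>2) / (1 - (norm z)\<^sup>2)"
proof -
  have "(1 - (norm (eta M z))\<^sup>2) / (1 - (norm z)\<^sup>2) = Q z / (norm (K z))\<^sup>2"
    using one_minus_norm_sq_pos[OF z] by (simp add: one_minus_norm_eta_sq[OF z])
  then show ?thesis
    using norm_K'_le[OF z] by (simp add: norm_divide norm_power divide_right_mono)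
qed

text \<open>Because \<open>1 - eta M z = 1 / K z\<close>, the Herglotz quotient is
  \<open>2 * K z - 1\<close>. This factors the density into a distance to the circle and
  \<open>Q\<close>.\<close>

lemma Re_herglotz_eta:
  assumes z: "norm z < 1"
  shows "Re ((1 + eta M z) / (1 - eta M z)) = (1 - (norm z)\<^sup>2) * Q z"
proof -
  have "(1 + eta M z) / (1 - eta M z) = 2 * K z - 1"
    using K_nonzero[OF z] by (simp add: eta_eq[OF z] field_simps)
  then show ?thesis using Re_K_prob[OF z] by simp
qed

text \<open>The choice in \<open>eta_inv\<close> needs a witness: the derivative of
  \<open>eta M\<close> at 0 is the mean, so a nonzero mean gives a holomorphic local
  inverse.\<close>

lemma eta_inv_is_local_inverse:
  assumes mean: "(LINT t|M. t) \<noteq> 0"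
  shows "is_local_inverse_at_0 (eta M) (eta_inv M)"
proof -
  have "deriv (eta M) 0 = (LINT t|M. t)"
    using DERIV_imp_deriv[OF eta_has_field_derivative[of 0]] by (simp add: K'_def K_def prob_space)
  then obtain r where r: "r > 0" "ball 0 r \<subseteq> ball (0::complex) 1" "open (eta M ` ball 0 r)" "inj_on (eta M) (ball 0 r)"
    using has_complex_derivative_locally_invertible[OF eta_holomorphic, of 0] mean by auto
  obtain h where h: "h holomorphic_on eta M ` ball 0 r" "\<And>z. z \<in> ball 0 r \<Longrightarrow> h (eta M z) = z"
    using holomorphic_has_inverse[OF holomorphic_on_subset[OF eta_holomorphic r(2)] open_ball r(4)] by metis
  have 0: "0 \<in> eta M ` ball 0 r"
    using r(1) eta_0 by (metis centre_in_ball image_eqI)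
  have "is_local_inverse_at_0 (eta M) h"
    unfolding is_local_inverse_at_0_def
  proof (intro conjI eventually_conj)
    show "h analytic_on {0}"
      using h(1) r(3) 0 analytic_at by blast
    show "h 0 = 0" using h(2)[of 0] r(1) by simp
    show "\<forall>\<^sub>F z in nhds 0. eta M (h z) = z"
      using eventually_nhds_in_open[OF r(3) 0] by eventually_elim (auto simp: h(2))
    show "\<forall>\<^sub>F z in nhds 0. h (eta M z) = z"
      using eventually_nhds_in_open[OF open_ball, of "0 :: complex" 0 r] r(1)
      by (auto elim!: eventually_mono simp del: mem_ball intro: h(2))
  qed
  then show ?thesis unfolding eta_inv_def by (rule someI[of "is_local_inverse_at_0 (eta M)"])
qed

end

subsection \<open>The subordination function\<close>

locale herglotz_exponent =
  \<mu>: circle_prob \<mu> + \<sigma>: circle_kernel \<sigma> cnj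
  for \<mu> \<sigma> :: "complex measure"
begin

text \<open>\<open>\<integral> (t + \<eta>) / (t - \<eta>) d\<sigma>\<close> at \<open>\<eta> = eta \<mu> z\<close>, rewritten with
  \<open>(t + \<eta>) / (t - \<eta>) = 2 / (1 - cnj t * \<eta>) - 1\<close>, which holds on the circle.\<close>

definition u :: "complex \<Rightarrow> complex" where
  "u z = 2 * \<sigma>.K (eta \<mu> z) - of_real (measure \<sigma> (space \<sigma>))"

lemma Re_u: "norm z < 1 \<Longrightarrow> Re (u z) = (1 - (norm (eta \<mu> z))\<^sup>2) * \<sigma>.Q (eta \<mu> z)"
  unfolding u_def using \<sigma>.Re_K[OF \<mu>.norm_eta_less] by simp

text \<open>The chain rule multiplies the bound \<open>\<sigma>.Q\<close> for the outer derivative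
  by the Schwarz-Pick bound for \<open>eta \<mu>\<close>; the numerators combine to
  \<open>Re (u z)\<close>.\<close>

lemma u_has_field_derivative:
  assumes z: "norm z < 1"
  obtains D where "(u has_field_derivative D) (at z)" "norm D \<le> 2 * Re (u z) / (1 - (norm z)\<^sup>2)"
proof
  define E where "E = \<mu>.K' z / (\<mu>.K z)\<^sup>2"
  show "(u has_field_derivative 2 * (\<sigma>.K' (eta \<mu> z) * E)) (at z)"
  proof -
    have "((\<lambda>z. \<sigma>.K (eta \<mu> z)) has_field_derivative \<sigma>.K' (eta \<mu> z) * E) (at z)"
      unfolding E_def
      by (rule DERIV_chain2[where f = \<sigma>.K and g = "eta \<mu>"])
         (intro \<sigma>.K_has_field_derivative \<mu>.norm_eta_less \<mu>.eta_has_field_derivative z)+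
    then show ?thesis
      unfolding u_def by (auto intro!: derivative_eq_intros)
  qed
  have "norm (\<sigma>.K' (eta \<mu> z) * E) \<le> \<sigma>.Q (eta \<mu> z) * ((1 - (norm (eta \<mu> z))\<^sup>2) / (1 - (norm z)\<^sup>2))"
    unfolding norm_mult E_def
    using \<sigma>.norm_K'_le[OF \<mu>.norm_eta_less[OF z]]
    by (intro mult_mono \<mu>.norm_deriv_eta_le[OF z]) (auto intro: order_trans[OF norm_ge_zero])
  then show "norm (2 * (\<sigma>.K' (eta \<mu> z) * E)) \<le> 2 * Re (u z) / (1 - (norm z)\<^sup>2)"
    by (simp add: Re_u[OF z] norm_mult mult_ac)
qed

lemma u_continuous: "norm z < 1 \<Longrightarrow> isCont u z"
  by (metis u_has_field_derivative DERIV_isCont)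

lemma u_holomorphic: "u holomorphic_on ball 0 1"
  using u_has_field_derivative by (fastforce simp: holomorphic_on_open)

end

text \<open>The assumption \<open>inverse\<close> says that
  \<open>w \<mapsto> \<gamma> * w * exp (u w)\<close> is a left inverse of \<open>eta \<rho>\<close>
  on the whole disk and not only near 0.\<close>

locale subordination = herglotz_exponent \<mu> \<sigma> + \<rho>: circle_prob \<rho>
  for \<mu> \<rho> \<sigma> :: "complex measure" +
  fixes \<gamma> :: complex
  assumes norm_\<gamma>: "norm \<gamma> = 1" and \<sigma>_nonzero: "measure \<sigma> (space \<sigma>) > 0"
    and inverse: "norm z < 1 \<Longrightarrow> \<gamma> * eta \<rho> z * exp (u (eta \<rho> z)) = z"
begin

lemma \<omega>_nonzero: "norm z < 1 \<Longrightarrow> z \<noteq> 0 \<Longrightarrow> eta \<rho> z \<noteq> 0"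
  using inverse[of z] by auto

lemma norm_inverse: "norm z < 1 \<Longrightarrow> norm (eta \<rho> z) * exp (Re (u (eta \<rho> z))) = norm z"
  using arg_cong[OF inverse[of z], of norm] by (simp add: norm_mult norm_\<gamma>)

text \<open>As \<open>w\<close> tends to 0, so does \<open>norm w * exp (Re (u w))\<close>. At
  \<open>w = eta \<rho> z\<close> this product is \<open>norm z\<close>, which is at least
  \<open>1 / 2\<close> here.\<close>

lemma \<omega>_bounded_below:
  obtains \<epsilon> where "\<epsilon> > 0" "\<And>z. 1 / 2 \<le> norm z \<Longrightarrow> norm z < 1 \<Longrightarrow> \<epsilon> \<le> norm (eta \<rho> z)"
proof -
  have "((\<lambda>w. norm w * exp (Re (u w))) \<longlongrightarrow> norm (0::complex) * exp (Re (u 0))) (at 0)"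
    using u_continuous[of 0] unfolding isCont_def by (intro tendsto_intros) auto
  then have "\<forall>\<^sub>F w in at 0. norm w * exp (Re (u w)) < 1 / 2"
    by (rule order_tendstoD) simp
  then obtain \<epsilon> where \<epsilon>: "\<epsilon> > 0" "\<And>w. w \<noteq> 0 \<Longrightarrow> norm w < \<epsilon> \<Longrightarrow> norm w * exp (Re (u w)) < 1 / 2"
    by (auto simp: eventually_at)
  show ?thesis
  proof (rule that[OF \<epsilon>(1)])
    fix z :: complex assume z: "1 / 2 \<le> norm z" "norm z < 1"
    show "\<epsilon> \<le> norm (eta \<rho> z)"
      using \<epsilon>(2)[of "eta \<rho> z"] norm_inverse[OF z(2)] \<omega>_nonzero[OF z(2)] z by force
  qed
qed

text \<open>On the annulus \<open>eta \<rho> z\<close> stays away from 0, so \<open>x\<close> is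
  bounded by \<open>X\<close> and the constant \<open>6 + X^2\<close> is uniform. The factor 2 comes
  from \<open>norm z \<ge> 1 / 2\<close>.\<close>

lemma norm_deriv_\<omega>_le_annulus:
  obtains C where "C \<ge> 0"
    "\<And>z. 1 / 2 \<le> norm z \<Longrightarrow> norm z < 1 \<Longrightarrow> norm (deriv (eta \<rho>) z) \<le> C * (1 - norm z) powr (- (2 / 3))"
proof -
  obtain \<epsilon> where \<epsilon>: "\<epsilon> > 0" "\<And>z. 1 / 2 \<le> norm z \<Longrightarrow> norm z < 1 \<Longrightarrow> \<epsilon> \<le> norm (eta \<rho> z)"
    using \<omega>_bounded_below by blast
  define X where "X = - ln \<epsilon>"
  show ?thesis
  proof (rule that)
    show "0 \<le> 2 * (6 + X\<^sup>2)" by simp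
    fix z :: complex assume z: "1 / 2 \<le> norm z" "norm z < 1"
    define w where "w = eta \<rho> z"
    define x where "x = - ln (norm w)"
    define y where "y = - ln (norm z)"
    have w: "norm w < 1" "\<epsilon> \<le> norm w" "w \<noteq> 0"
      using \<rho>.norm_eta_less[OF z(2)] \<epsilon>(2)[OF z] \<epsilon>(1) by (auto simp: w_def)
    have Re_u_w: "Re (u w) = x - y"
    proof -
      have "ln (norm w * exp (Re (u w))) = ln (norm z)"
        using norm_inverse[OF z(2)] by (simp add: w_def)
      then show ?thesis using w(3) by (simp add: x_def y_def ln_mult)
    qed
    have "0 \<le> Re (u w)"
      unfolding Re_u[OF w(1)] using \<sigma>.Q_ge[OF \<mu>.norm_eta_less[OF w(1)]] \<sigma>_nonzero
        one_minus_norm_sq_pos[OF \<mu>.norm_eta_less[OF w(1)]] by (intro mult_nonneg_nonneg) auto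
    moreover have "ln (norm z) < 0"
    proof -
      have "0 < norm z" using z by linarith
      then show ?thesis using z by simp
    qed
    ultimately have xy: "0 < y" "y \<le> x" "x \<le> X"
      using w \<epsilon>(1) Re_u_w by (auto simp: y_def x_def X_def)
    have y_ge: "1 - norm z \<le> y"
      using ln_le_minus_one[of "norm z"] z by (cases "z = 0") (auto simp: y_def)
    \<comment> \<open>This identity turns the Schwarz-Pick bound for \<open>w * D\<close> into
      \<open>(x - y) / sinh x\<close>.\<close>
    have "sinh x = (1 - (norm w)\<^sup>2) / (2 * norm w)"
      using w by (simp add: x_def sinh_ln_real field_simps power2_eq_square)
    then have sinh_x: "1 / sinh x = 2 * norm w / (1 - (norm w)\<^sup>2)" by simp
    obtain D where D: "(u has_field_derivative D) (at w)" "norm D \<le> 2 * Re (u w) / (1 - (norm w)\<^sup>2)"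
      using u_has_field_derivative[OF w(1)] .
    define d where "d = deriv (eta \<rho>) z"
    have eta': "(eta \<rho> has_field_derivative d) (at z)"
      using \<rho>.eta_has_field_derivative[OF z(2)] by (simp add: d_def DERIV_imp_deriv)
    have "((\<lambda>z. \<gamma> * eta \<rho> z * exp (u (eta \<rho> z))) has_field_derivative
        \<gamma> * exp (u w) * d * (1 + w * D)) (at z)"
      using D(1) eta' unfolding w_def
      by (auto intro!: derivative_eq_intros DERIV_chain2[of u] simp: algebra_simps)
    moreover have "((\<lambda>z. \<gamma> * eta \<rho> z * exp (u (eta \<rho> z))) has_field_derivative 1) (at z)"
      by (rule has_field_derivative_transform_within_open[OF DERIV_ident open_ball[of 0 1]])
         (use z inverse in auto)
    ultimately have "\<gamma> * exp (u w) * d * (1 + w * D) = 1"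
      by (rule DERIV_unique)
    \<comment> \<open>Multiplying by \<open>w\<close> completes the factor
      \<open>\<gamma> * w * exp (u w)\<close>, which is \<open>z\<close>; the exponential
      disappears.\<close>
    then have "w * (\<gamma> * exp (u w) * d * (1 + w * D)) = w" by simp
    moreover have "w * (\<gamma> * exp (u w) * d * (1 + w * D)) = (\<gamma> * w * exp (u w)) * d * (1 + w * D)"
      by (simp only: mult_ac)
    moreover have "\<gamma> * w * exp (u w) = z"
      unfolding w_def by (rule inverse[OF z(2)])
    ultimately have eq: "z * d * (1 + w * D) = w" by simp
    have "norm (w * D) \<le> norm w * (2 * Re (u w) / (1 - (norm w)\<^sup>2))"
      unfolding norm_mult using D(2) by (intro mult_left_mono) auto
    also have "\<dots> = (x - y) * (1 / sinh x)"
      unfolding sinh_x Re_u_w by (simp add: mult_ac)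
    also have "\<dots> = (x - y) / sinh x" by simp
    finally have "1 - (x - y) / sinh x \<le> norm (1 + w * D)"
      using norm_triangle_ineq2[of 1 "- (w * D)"] by simp
    then have ge: "y powr (2 / 3) / (6 + X\<^sup>2) \<le> norm (1 + w * D)"
      using one_minus_div_sinh_ge[OF xy] by linarith
    have "(1 / 2) * norm d * ((1 - norm z) powr (2 / 3) / (6 + X\<^sup>2)) \<le>
        norm z * norm d * (y powr (2 / 3) / (6 + X\<^sup>2))"
      using z y_ge by (intro mult_mono divide_right_mono powr_mono2) auto
    also have "\<dots> \<le> norm z * norm d * norm (1 + w * D)"
      by (intro mult_left_mono ge) auto
    also have "\<dots> \<le> 1"
      using arg_cong[OF eq, of norm] w(1) by (simp add: norm_mult)
    finally have le: "(1 / 2) * norm d * ((1 - norm z) powr (2 / 3) / (6 + X\<^sup>2)) \<le> 1" .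
    have "0 < (1 - norm z) powr (2 / 3)" "0 < 6 + X\<^sup>2" using z by (auto simp: add_pos_nonneg)
    then show "norm (deriv (eta \<rho>) z) \<le> 2 * (6 + X\<^sup>2) * (1 - norm z) powr (- (2 / 3))"
      using le by (simp add: d_def powr_minus field_simps)
  qed
qed

text \<open>The remaining disk of radius \<open>1 / 2\<close> is handled by compactness, as the
  negative power is at least 1 there. The exponent is written to fit the Hoelder lemma with
  \<open>\<alpha> = 1 / 3\<close>.\<close>

lemma norm_deriv_\<omega>_le:
  obtains C where "C \<ge> 0"
    "\<And>z. norm z < 1 \<Longrightarrow> norm (deriv (eta \<rho>) z) \<le> C * (1 - norm z) powr (1 / 3 - 1)"
proof -
  obtain C where C: "C \<ge> 0"
    "\<And>z. 1 / 2 \<le> norm z \<Longrightarrow> norm z < 1 \<Longrightarrow> norm (deriv (eta \<rho>) z) \<le> C * (1 - norm z) powr (- (2 / 3))"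
    using norm_deriv_\<omega>_le_annulus by blast
  have "continuous_on (cball 0 (1 / 2)) (deriv (eta \<rho>))"
    by (rule holomorphic_on_imp_continuous_on[OF holomorphic_on_subset[OF
          holomorphic_deriv[OF \<rho>.eta_holomorphic open_ball]]]) auto
  then have "bounded (deriv (eta \<rho>) ` cball 0 (1 / 2))"
    by (intro compact_imp_bounded compact_continuous_image) auto
  then obtain B where B: "B > 0" "\<And>z. norm z \<le> 1 / 2 \<Longrightarrow> norm (deriv (eta \<rho>) z) \<le> B"
    by (auto simp: bounded_pos)
  show ?thesis
  proof (rule that)
    show "0 \<le> B + C" using B C by simp
    fix z :: complex assume z: "norm z < 1"
    have "1 powr (- (2 / 3)) \<le> (1 - norm z) powr (- (2 / 3))"
      using z by (intro powr_mono2') auto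
    then have 1: "1 \<le> (1 - norm z) powr (- (2 / 3))" by simp
    show "norm (deriv (eta \<rho>) z) \<le> (B + C) * (1 - norm z) powr (1 / 3 - 1)"
    proof (cases "norm z \<le> 1 / 2")
      case True
      have "norm (deriv (eta \<rho>) z) \<le> B * 1" using B(2)[OF True] by simp
      also have "\<dots> \<le> (B + C) * (1 - norm z) powr (- (2 / 3))"
        using B(1) C(1) 1 by (intro mult_mono) auto
      finally show ?thesis by simp
    next
      case False
      then have "norm (deriv (eta \<rho>) z) \<le> C * (1 - norm z) powr (- (2 / 3))"
        using C(2) z by simp
      also have "\<dots> \<le> (B + C) * (1 - norm z) powr (- (2 / 3))"
        using B(1) by (intro mult_right_mono) auto
      finally show ?thesis by simp
    qed
  qed
qed

lemma \<omega>_holder: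
  obtains C where "C \<ge> 0"
    "\<And>a b. norm a < 1 \<Longrightarrow> norm b < 1 \<Longrightarrow> norm (a - b) \<le> 1 \<Longrightarrow>
      norm (eta \<rho> a - eta \<rho> b) \<le> C * norm (a - b) powr (1 / 3)"
proof -
  obtain C where C: "C \<ge> 0"
    "\<And>z. norm z < 1 \<Longrightarrow> norm (deriv (eta \<rho>) z) \<le> C * (1 - norm z) powr (1 / 3 - 1)"
    using norm_deriv_\<omega>_le by blast
  show ?thesis
    using C(1) holder_of_deriv_bound[OF \<rho>.eta_holomorphic _ _ C]
    by (intro that[of "2 * C / (1 / 3) + C"]) auto
qed

end

subsection \<open>The density near one of its zeros\<close>

context subordination
begin

text \<open>On the critical set \<open>Re (u w) = - ln (norm w)\<close> one has \<open>Q w \<le> c * (norm (K w))\<^sup>2\<close>, a reverse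
  Cauchy-Schwarz inequality for \<open>1 / (1 - t * w)\<close>. If \<open>K\<close> were unbounded there, the mass would
  concentrate at \<open>1 / w\<^sub>0\<close>.\<close>

lemma Q_bounded_near_non_atom:
  assumes w0: "norm w\<^sub>0 = 1" and atom: "measure \<mu> {1 / w\<^sub>0} = 0"
  obtains B \<delta> where "B \<ge> 0" "\<delta> > 0"
    "\<And>w. norm w < 1 \<Longrightarrow> norm (w - w\<^sub>0) < \<delta> \<Longrightarrow> Re (u w) = - ln (norm w) \<Longrightarrow> \<mu>.Q w \<le> B"
proof -
  \<comment> \<open>The 8 is 4 from \<open>Q_ge\<close> for \<open>\<sigma>\<close> times 2 from
    \<open>- ln (norm w) \<le> 2 * (1 - (norm w)^2)\<close>, valid for
    \<open>norm w \<ge> 1 / 2\<close>.\<close>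
  define c where "c = 8 / measure \<sigma> (space \<sigma>)"
  have c: "c > 0" using \<sigma>_nonzero by (simp add: c_def)
  have space: "space \<mu> = sphere 0 1"
    using sets_eq_imp_space_eq[OF \<mu>.sets_M] by (simp add: space_restrict_space)
  define N where "N = (\<lambda>n::nat. {t \<in> space \<mu>. norm (t - 1 / w\<^sub>0) \<le> inverse (real (Suc n))})"
  have N_sets: "N n \<in> sets \<mu>" for n
    unfolding N_def using \<mu>.g_measurable by measurable
  have "(\<lambda>n. measure \<mu> (N n)) \<longlonglongrightarrow> measure \<mu> (\<Inter>n. N n)"
  proof (rule \<mu>.finite_Lim_measure_decseq)
    show "range N \<subseteq> sets \<mu>" using N_sets by auto
    show "decseq N"
    proof (rule antimonoI)
      fix m n :: nat assume "m \<le> n"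
      then have "inverse (real (Suc n)) \<le> inverse (real (Suc m))" by (intro le_imp_inverse_le) auto
      then show "N n \<subseteq> N m" unfolding N_def by (blast intro: order_trans)
    qed
  qed
  also have "(\<Inter>n. N n) = {1 / w\<^sub>0}"
  proof
    show "{1 / w\<^sub>0} \<subseteq> (\<Inter>n. N n)" using w0 by (auto simp: N_def space norm_divide)
    show "(\<Inter>n. N n) \<subseteq> {1 / w\<^sub>0}"
    proof
      fix t assume t: "t \<in> (\<Inter>n. N n)"
      have "norm (t - 1 / w\<^sub>0) \<le> 0"
        by (rule LIMSEQ_le_const[OF LIMSEQ_inverse_real_of_nat]) (use t in \<open>auto simp: N_def\<close>)
      then show "t \<in> {1 / w\<^sub>0}" by simp
    qed
  qed
  finally have "(\<lambda>n. measure \<mu> (N n)) \<longlonglongrightarrow> 0" by (simp add: atom)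
  \<comment> \<open>The threshold makes the part of the integral over \<open>N n\<close> contribute
    at most \<open>k / 4\<close> below, where \<open>l = 2 * c * k\<close>.\<close>
  then have "\<forall>\<^sub>F n in sequentially. measure \<mu> (N n) < 1 / (4 * c)"
    using c by (intro order_tendstoD) auto
  then obtain n where n: "measure \<mu> (N n) < 1 / (4 * c)"
    by (auto simp: eventually_sequentially)
  define \<epsilon> where "\<epsilon> = inverse (real (Suc n))"
  have \<epsilon>: "\<epsilon> > 0" by (simp add: \<epsilon>_def)
  \<comment> \<open>For \<open>t\<close> outside \<open>N n\<close> and \<open>w\<close> within
    \<open>\<epsilon> / 2\<close> of \<open>w\<^sub>0\<close>, the denominator
    \<open>1 - t * w\<close> has modulus at least \<open>\<epsilon> / 2\<close>.\<close>
  define b where "b = 2 / \<epsilon>"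
  have b: "b > 0" using \<epsilon> by (simp add: b_def)
  show ?thesis
  proof (rule that)
    show "0 \<le> c * (2 * b)\<^sup>2" "0 < min (1 / 2) (\<epsilon> / 2)" using c \<epsilon> by auto
    fix w assume w: "norm w < 1" and near: "norm (w - w\<^sub>0) < min (1 / 2) (\<epsilon> / 2)"
      and crit: "Re (u w) = - ln (norm w)"
    have w_ge: "1 / 2 \<le> norm w"
      using near norm_triangle_ineq2[of w\<^sub>0 w] w0 by (simp add: norm_minus_commute)
    note \<eta> = \<mu>.norm_eta_less[OF w]
    \<comment> \<open>By \<open>one_minus_norm_eta_sq\<close>, bounding
      \<open>Q / (norm K)^2\<close> means comparing \<open>1 - (norm (eta \<mu> w))^2\<close> with
      \<open>1 - (norm w)^2\<close>. The critical equation does this, since \<open>Re (u w)\<close>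
      is at least a multiple of the former.\<close>
    have Q_le: "\<mu>.Q w \<le> c * (norm (\<mu>.K w))\<^sup>2"
    proof -
      have "(1 - (norm (eta \<mu> w))\<^sup>2) * (measure \<sigma> (space \<sigma>) / 4) \<le> - ln (norm w)"
        unfolding crit[symmetric] Re_u[OF w]
        using \<sigma>.Q_ge[OF \<eta>] one_minus_norm_sq_pos[OF \<eta>] by (intro mult_left_mono) auto
      also have "- ln (norm w) = ln (1 / norm w)" using w_ge by (simp add: ln_div)
      also have "\<dots> \<le> 1 / norm w - 1" using w_ge by (intro ln_le_minus_one) auto
      also have "\<dots> \<le> 2 * (1 - (norm w)\<^sup>2)"
      proof -
        have "1 / norm w - 1 = (1 - norm w) * (1 / norm w)"
          using w_ge by (cases "w = 0") (auto simp: field_simps)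
        also have "\<dots> \<le> (1 - norm w) * (2 * (1 + norm w))"
        proof (intro mult_left_mono)
          have "1 / norm w \<le> 1 / (1 / 2)" using w_ge by (intro frac_le) auto
          then show "1 / norm w \<le> 2 * (1 + norm w)" by (simp add: add_increasing2)
        qed (use w in auto)
        also have "\<dots> = 2 * (1 - (norm w)\<^sup>2)" by (simp add: power2_eq_square algebra_simps)
        finally show ?thesis .
      qed
      finally have "1 - (norm (eta \<mu> w))\<^sup>2 \<le> c * (1 - (norm w)\<^sup>2)"
        using \<sigma>_nonzero by (simp add: c_def field_simps)
      then have "(1 - (norm w)\<^sup>2) * (\<mu>.Q w / (norm (\<mu>.K w))\<^sup>2) \<le> (1 - (norm w)\<^sup>2) * c"
        by (simp add: \<mu>.one_minus_norm_eta_sq[OF w] mult.commute)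
      then have "\<mu>.Q w / (norm (\<mu>.K w))\<^sup>2 \<le> c"
        using one_minus_norm_sq_pos[OF w] by (simp only: mult_le_cancel_left_pos)
      then show ?thesis using \<mu>.K_nonzero[OF w] by (simp add: pos_divide_le_eq)
    qed
    define k where "k = norm (\<mu>.K w)"
    have k: "k > 0" using \<mu>.K_nonzero[OF w] by (simp add: k_def)
    \<comment> \<open>With \<open>l = 2 * c * k\<close> the last two terms are at most
      \<open>k / 4\<close> each and are absorbed on the left, leaving
      \<open>k \<le> 2 * b\<close>.\<close>
    have "k \<le> b * measure \<mu> (space \<mu>) + 2 * c * k / 2 * measure \<mu> (N n) + \<mu>.Q w / (2 * (2 * c * k))"
      unfolding k_def
    proof (rule \<mu>.norm_K_le[OF w N_sets])
      show "0 < 2 * c * norm (\<mu>.K w)" using c k by (simp add: k_def)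
      show "0 \<le> b" using b by simp
      fix t assume t: "t \<in> space \<mu> - N n"
      then have nt: "norm t = 1" and far: "norm (t - 1 / w\<^sub>0) > \<epsilon>" by (auto simp: N_def \<epsilon>_def space)
      have "norm (1 - t * w\<^sub>0) = norm (w\<^sub>0 * (1 / w\<^sub>0 - t))"
        using w0 by (intro arg_cong[of _ _ norm]) (auto simp: field_simps)
      then have "norm (1 - t * w\<^sub>0) = norm (t - 1 / w\<^sub>0)"
        by (simp add: norm_mult w0 norm_minus_commute)
      moreover have "norm (1 - t * w\<^sub>0) \<le> norm (1 - t * w) + norm (t * (w - w\<^sub>0))"
        using norm_triangle_ineq[of "1 - t * w" "t * (w - w\<^sub>0)"] by (simp add: algebra_simps)
      moreover have "norm (t * (w - w\<^sub>0)) = norm (w - w\<^sub>0)" by (simp add: norm_mult nt)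
      ultimately have "\<epsilon> / 2 \<le> norm (1 - t * w)" using near far by simp
      then have "1 / norm (1 - t * w) \<le> 1 / (\<epsilon> / 2)" using \<epsilon> by (intro frac_le) auto
      then show "norm (1 / (1 - t * w)) \<le> b" by (simp add: norm_divide b_def)
    qed
    also have "\<mu>.Q w / (2 * (2 * c * k)) \<le> c * k\<^sup>2 / (2 * (2 * c * k))"
      using Q_le c k by (intro divide_right_mono) (auto simp: k_def)
    also have "\<dots> = k / 4" using c k by (simp add: power2_eq_square)
    also have "2 * c * k / 2 * measure \<mu> (N n) \<le> 2 * c * k / 2 * (1 / (4 * c))"
      using n c k by (intro mult_left_mono) auto
    also have "\<dots> = k / 4" using c by simp
    finally have "k \<le> 2 * b" by (simp add: \<mu>.prob_space)
    then have "c * k\<^sup>2 \<le> c * (2 * b)\<^sup>2" using c k by (intro mult_left_mono power_mono) auto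
    then show "\<mu>.Q w \<le> c * (2 * b)\<^sup>2" using Q_le by (simp add: k_def)
  qed
qed

lemma conv_density_eq:
  "conv_density \<mu> \<rho> \<xi> = (let w = disk_ext (eta \<rho>) (cnj \<xi>) in
     if norm w < 1 then (1 - (norm w)\<^sup>2) * \<mu>.Q w / (2 * pi) else 0)"
  unfolding conv_density_def Let_def by (simp add: \<mu>.Re_herglotz_eta)

lemma \<mu>_Q_pos: "norm w < 1 \<Longrightarrow> \<mu>.Q w > 0"
  using \<mu>.Q_ge[of w] by (simp add: \<mu>.prob_space)

text \<open>Positivity of the density puts \<open>w\<close> in the open disk, where the critical
  equation gives \<open>Q w \<le> B\<close>. The other factor is at most
  \<open>2 * norm (w - w0)\<close>, to which the Hoelder bound applies.\<close>

lemma conv_density_bound_near_zero: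
  assumes \<xi>0: "norm \<xi>\<^sub>0 = 1" and zero: "conv_density \<mu> \<rho> \<xi>\<^sub>0 = 0"
    and atom: "measure \<mu> {1 / disk_ext (eta \<rho>) (cnj \<xi>\<^sub>0)} = 0"
  obtains A \<delta> where "\<delta> > 0"
    "\<And>\<xi>. norm \<xi> = 1 \<Longrightarrow> norm (\<xi> - \<xi>\<^sub>0) < \<delta> \<Longrightarrow> conv_density \<mu> \<rho> \<xi> > 0 \<Longrightarrow>
      conv_density \<mu> \<rho> \<xi> \<le> A * norm (\<xi> - \<xi>\<^sub>0) powr (1 / 3)"
proof -
  obtain C where C: "C \<ge> 0"
    "\<And>a b. norm a < 1 \<Longrightarrow> norm b < 1 \<Longrightarrow> norm (a - b) \<le> 1 \<Longrightarrow>
      norm (eta \<rho> a - eta \<rho> b) \<le> C * norm (a - b) powr (1 / 3)"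
    using \<omega>_holder by blast
  have third: "0 < (1 / 3 :: real)" by simp
  note lim = tendsto_disk_ext_of_holder[OF third C]
  note diff = norm_disk_ext_diff_le[OF third C]
  define w0 where "w0 = disk_ext (eta \<rho>) (cnj \<xi>\<^sub>0)"
  have nontrivial: "at \<zeta> within ball 0 1 \<noteq> bot" if "norm \<zeta> = 1" for \<zeta> :: complex
    using that by (simp add: trivial_limit_within islimpt_ball)
  have in_ball: "\<forall>\<^sub>F z in at \<zeta> within ball 0 1. norm z < 1" for \<zeta> :: complex
    by (simp add: eventually_at_filter)
  \<comment> \<open>A boundary value inside the disk would give a strictly positive density at
    \<open>\<xi>\<^sub>0\<close>.\<close>
  have w0: "norm w0 = 1"
  proof (rule antisym)
    show "norm w0 \<le> 1"
    proof (rule tendsto_upperbound)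
      show "((\<lambda>z. norm (eta \<rho> z)) \<longlongrightarrow> norm w0) (at (cnj \<xi>\<^sub>0) within ball 0 1)"
        unfolding w0_def using \<xi>0 by (intro tendsto_norm lim) auto
      show "\<forall>\<^sub>F z in at (cnj \<xi>\<^sub>0) within ball 0 1. norm (eta \<rho> z) \<le> 1"
        using in_ball by eventually_elim (simp add: \<rho>.norm_eta_less less_imp_le)
    qed (use nontrivial \<xi>0 in auto)
    show "1 \<le> norm w0"
    proof (rule ccontr)
      assume "\<not> 1 \<le> norm w0"
      then have "conv_density \<mu> \<rho> \<xi>\<^sub>0 > 0"
        using one_minus_norm_sq_pos[of w0] \<mu>_Q_pos[of w0] by (simp add: conv_density_eq w0_def Let_def)
      then show False using zero by simp
    qed
  qed
  obtain B \<delta> where B: "B \<ge> 0" "\<delta> > 0"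
    "\<And>w. norm w < 1 \<Longrightarrow> norm (w - w0) < \<delta> \<Longrightarrow> Re (u w) = - ln (norm w) \<Longrightarrow> \<mu>.Q w \<le> B"
    using Q_bounded_near_non_atom[OF w0] atom w0_def by metis
  \<comment> \<open>Cubing inverts the exponent \<open>1 / 3\<close>, so the Hoelder bound keeps
    \<open>w\<close> within \<open>\<delta>\<close> of \<open>w0\<close>.\<close>
  define \<delta>' where "\<delta>' = min 1 ((\<delta> / (C + 1)) ^ 3)"
  show ?thesis
  proof (rule that)
    show "0 < \<delta>'" using B(2) C(1) by (simp add: \<delta>'_def)
    fix \<xi> assume \<xi>: "norm \<xi> = 1" and near: "norm (\<xi> - \<xi>\<^sub>0) < \<delta>'" and pos: "conv_density \<mu> \<rho> \<xi> > 0"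
    define w where "w = disk_ext (eta \<rho>) (cnj \<xi>)"
    have w: "norm w < 1" using pos by (auto simp: conv_density_eq w_def Let_def split: if_splits)
    have dens: "conv_density \<mu> \<rho> \<xi> = (1 - (norm w)\<^sup>2) * \<mu>.Q w / (2 * pi)"
      using w by (simp add: conv_density_eq w_def Let_def)
    have diff_cnj: "norm (cnj \<xi> - cnj \<xi>\<^sub>0) = norm (\<xi> - \<xi>\<^sub>0)"
      by (metis complex_cnj_diff complex_mod_cnj)
    have w_diff: "norm (w - w0) \<le> C * norm (\<xi> - \<xi>\<^sub>0) powr (1 / 3)"
      unfolding w_def w0_def diff_cnj[symmetric] using \<xi> \<xi>0 near diff_cnj
      by (intro diff) (auto simp: \<delta>'_def)
    also have "\<dots> \<le> C * (\<delta> / (C + 1))"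
    proof (intro mult_left_mono C)
      have "norm (\<xi> - \<xi>\<^sub>0) powr (1 / 3) \<le> ((\<delta> / (C + 1)) ^ 3) powr (1 / 3)"
        using near by (intro powr_mono2) (auto simp: \<delta>'_def)
      also have "\<dots> = \<delta> / (C + 1)"
        using B(2) C(1) by (simp add: powr_realpow[symmetric] powr_powr del: powr_numeral)
      finally show "norm (\<xi> - \<xi>\<^sub>0) powr (1 / 3) \<le> \<delta> / (C + 1)" .
    qed
    also have "\<dots> < \<delta>" using B(2) C(1) by (simp add: field_simps)
    finally have w_near: "norm (w - w0) < \<delta>" .
    \<comment> \<open>Let \<open>z\<close> tend to the circle in \<open>norm_inverse\<close>:
      \<open>u\<close> is continuous at the interior point \<open>w\<close>, and
      \<open>norm z\<close> tends to 1.\<close>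
    have crit: "Re (u w) = - ln (norm w)"
    proof -
      have lim_w: "(eta \<rho> \<longlongrightarrow> w) (at (cnj \<xi>) within ball 0 1)"
        unfolding w_def using \<xi> by (intro lim) auto
      have "((\<lambda>z. norm (eta \<rho> z) * exp (Re (u (eta \<rho> z)))) \<longlongrightarrow> norm w * exp (Re (u w)))
          (at (cnj \<xi>) within ball 0 1)"
        by (intro tendsto_intros lim_w isCont_tendsto_compose[OF u_continuous[OF w] lim_w])
      then have "((\<lambda>z. norm z) \<longlongrightarrow> norm w * exp (Re (u w))) (at (cnj \<xi>) within ball 0 1)"
        by (rule Lim_transform_eventually) (use in_ball in eventually_elim, simp add: norm_inverse)
      moreover have "((\<lambda>z. norm z) \<longlongrightarrow> norm (cnj \<xi>)) (at (cnj \<xi>) within ball 0 1)"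
        by (intro tendsto_intros)
      ultimately have eq: "norm w * exp (Re (u w)) = 1"
        using tendsto_unique[OF nontrivial[of "cnj \<xi>"]] \<xi> by auto
      then have "w \<noteq> 0" by auto
      then show ?thesis using arg_cong[OF eq, of ln] by (simp add: ln_mult)
    qed
    have "1 - (norm w)\<^sup>2 = (1 - norm w) * (1 + norm w)" by (simp add: power2_eq_square algebra_simps)
    also have "\<dots> \<le> norm (w - w0) * 2"
      using norm_triangle_ineq2[of w0 w] w w0 by (intro mult_mono) (auto simp: norm_minus_commute)
    finally have "1 - (norm w)\<^sup>2 \<le> 2 * (C * norm (\<xi> - \<xi>\<^sub>0) powr (1 / 3))" using w_diff by simp
    then have "(1 - (norm w)\<^sup>2) * \<mu>.Q w \<le> 2 * (C * norm (\<xi> - \<xi>\<^sub>0) powr (1 / 3)) * B"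
      using B(1) B(3)[OF w w_near crit] C(1) \<mu>_Q_pos[OF w] by (intro mult_mono) auto
    then show "conv_density \<mu> \<rho> \<xi> \<le> C * B / pi * norm (\<xi> - \<xi>\<^sub>0) powr (1 / 3)"
      unfolding dens using divide_right_mono[of _ _ "2 * pi"] by (fastforce simp: mult_ac)
  qed
qed

end

section \<open>The subordination equation from the convolution identity\<close>

lemma circle_probI: "\<mu> \<in> prob_circle_star \<Longrightarrow> circle_prob \<mu>"
  by (auto simp: prob_circle_star_def prob_circle_def circle_prob_def circle_prob_axioms_def)

text \<open>Multiplying numerator and denominator by \<open>cnj t\<close>, with
  \<open>cnj t * t = 1\<close>, brings the Herglotz kernel to the form of
  \<open>circle_kernel\<close>.\<close>

lemma herglotz_kernel_integral:
  assumes \<sigma>: "\<sigma> \<in> finite_circle_measures" and w: "norm w < 1"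
  shows "(LINT t|\<sigma>. (t + w) / (t - w)) = 2 * circle_kernel.K \<sigma> cnj w - of_real (measure \<sigma> (space \<sigma>))"
proof -
  have fin: "finite_measure \<sigma>" and sets: "sets \<sigma> = sets circle_borel"
    using \<sigma> by (auto simp: finite_circle_measures_def)
  interpret circle_kernel \<sigma> cnj
    by (rule circle_kernelI[OF fin sets]) (auto intro!: borel_measurable_continuous_onI continuous_intros)
  have space: "space \<sigma> = sphere 0 1"
    using sets_eq_imp_space_eq[OF sets] by (simp add: space_restrict_space)
  define f where "f = (\<lambda>t. 1 / (1 - cnj t * w))"
  have f: "integrable \<sigma> f" "K w = (LINT t|\<sigma>. f t)"
    using integrable_K[OF w] by (simp_all add: f_def K_def)
  have "(LINT t|\<sigma>. (t + w) / (t - w)) = (LINT t|\<sigma>. 2 * f t - 1)"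
  proof (rule Bochner_Integration.integral_cong[OF refl])
    fix t assume t: "t \<in> space \<sigma>"
    have t1: "cnj t * t = 1" using t complex_norm_square[of t] by (simp add: space mult.commute)
    have nz: "1 - cnj t * w \<noteq> 0" using denominator_nonzero[OF t w] .
    have "cnj t \<noteq> 0" using t1 by auto
    then have "(t + w) / (t - w) = (cnj t * (t + w)) / (cnj t * (t - w))" by simp
    also have "\<dots> = (1 + cnj t * w) / (1 - cnj t * w)" by (simp add: distrib_left right_diff_distrib t1)
    also have "\<dots> = 2 * (1 / (1 - cnj t * w)) - 1" using nz by (simp add: field_simps)
    finally show "(t + w) / (t - w) = 2 * f t - 1" by (simp only: f_def)
  qed
  then show ?thesis using f(1) by (simp add: f(2) scaleR_conv_of_real)
qed

text \<open>At 0 the bound of \<open>K'\<close> by \<open>Q\<close> says that the mean has modulus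
  at most the total mass.\<close>

lemma finite_circle_measure_nonzero:
  assumes \<sigma>: "\<sigma> \<in> finite_circle_measures" and mean: "(LINT t|\<sigma>. t) \<noteq> 0"
  shows "measure \<sigma> (space \<sigma>) > 0"
proof -
  interpret circle_kernel \<sigma> "\<lambda>t. t"
    using \<sigma> by (intro circle_kernelI) (auto simp: finite_circle_measures_def)
  show ?thesis
    using norm_K'_le[of 0] mean by (simp add: K'_def Q_def) (metis norm_le_zero_iff not_less zero_less_measure_iff)
qed

theorem theorem7p4:
  fixes \<mu>\<^sub>1 \<mu>\<^sub>2 \<mu> \<rho>\<^sub>1 \<sigma> :: "complex measure"
    and \<gamma> \<xi>\<^sub>0 :: complex and \<Phi> :: "complex \<Rightarrow> complex" and \<Gamma> :: "complex set"
  assumes "\<mu>\<^sub>1 \<in> prob_circle_star" and "\<mu>\<^sub>2 \<in> prob_circle_star"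
    and "nondegenerate \<mu>\<^sub>1" and "nondegenerate \<mu>\<^sub>2"
    and "free_mult_inf_divisible \<mu>\<^sub>2"
    and "norm \<gamma> = 1" and "\<sigma> \<in> finite_circle_measures"
    and "\<And>z. z \<in> ball 0 1 \<Longrightarrow> \<Phi> z = \<gamma> * z * exp (LINT t|\<sigma>. (t + z) / (t - z))"
    and "\<Phi> holomorphic_on ball 0 1" and "\<forall>\<^sub>F z in nhds 0. \<Phi> z = eta_inv \<mu>\<^sub>2 z"
    and "(LINT t|\<sigma>. t) \<noteq> 0"
    and "is_free_mult_conv \<mu>\<^sub>1 \<mu>\<^sub>2 \<mu>"
    and "\<rho>\<^sub>1 \<in> prob_circle_star"
    and "\<And>z. z \<in> ball 0 1 \<Longrightarrow> eta \<mu> z = eta \<mu>\<^sub>1 (eta \<rho>\<^sub>1 z)"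
    and "open_arc_with_endpoint \<Gamma> \<xi>\<^sub>0"
    and "conv_density \<mu>\<^sub>1 \<rho>\<^sub>1 \<xi>\<^sub>0 = 0"
    and "\<And>\<xi>. \<xi> \<in> \<Gamma> \<Longrightarrow> conv_density \<mu>\<^sub>1 \<rho>\<^sub>1 \<xi> > 0"
    and "measure \<mu>\<^sub>1 {1 / disk_ext (eta \<rho>\<^sub>1) (cnj \<xi>\<^sub>0)} = 0"
  shows "\<exists>\<delta>>0. bounded ((\<lambda>\<xi>. conv_density \<mu>\<^sub>1 \<rho>\<^sub>1 \<xi> / norm (\<xi> - \<xi>\<^sub>0) powr (1/3)) ` (\<Gamma> \<inter> ball \<xi>\<^sub>0 \<delta>))"
proof -
  note star = assms(1) and \<sigma> = assms(7) and conv = assms(12) and \<rho>_star = assms(13)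
  have \<mu>_star: "\<mu> \<in> prob_circle_star" using conv by (simp add: is_free_mult_conv_def)
  interpret m1: circle_prob \<mu>\<^sub>1 by (rule circle_probI[OF star])
  interpret m: circle_prob \<mu> by (rule circle_probI[OF \<mu>_star])
  interpret r: circle_prob \<rho>\<^sub>1 by (rule circle_probI[OF \<rho>_star])
  interpret s: circle_kernel \<sigma> cnj
    using \<sigma> by (intro circle_kernelI)
      (auto simp: finite_circle_measures_def intro!: borel_measurable_continuous_onI continuous_intros)
  interpret herglotz_exponent \<mu>\<^sub>1 \<sigma> ..
  have exponent: "(LINT t|\<sigma>. (t + eta \<mu>\<^sub>1 w) / (t - eta \<mu>\<^sub>1 w)) = u w" if "norm w < 1" for w
    unfolding u_def by (rule herglotz_kernel_integral[OF \<sigma> m1.norm_eta_less[OF that]])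
  \<comment> \<open>Insert \<open>h = eta \<mu> z\<close> into the convolution identity. The two
    local inverses return \<open>z\<close> and \<open>eta \<rho>\<^sub>1 z\<close>, and dividing by
    \<open>h\<close> leaves the claim.\<close>
  have near_0: "\<forall>\<^sub>F z in nhds 0. \<gamma> * eta \<rho>\<^sub>1 z * exp (u (eta \<rho>\<^sub>1 z)) = z"
  proof -
    have lim: "filterlim (eta \<nu>) (nhds 0) (nhds 0)" if "circle_prob \<nu>" for \<nu>
    proof -
      interpret circle_prob \<nu> by fact
      have "isCont (eta \<nu>) 0" using DERIV_isCont[OF eta_has_field_derivative] by simp
      then show ?thesis by (simp add: isCont_def tendsto_at_iff_tendsto_nhds[of "eta \<nu>" 0, simplified])
    qed
    note \<mu>_lim = lim[OF m.circle_prob_axioms] and \<rho>_lim = lim[OF r.circle_prob_axioms]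
    have inv: "is_local_inverse_at_0 (eta \<mu>) (eta_inv \<mu>)" "is_local_inverse_at_0 (eta \<mu>\<^sub>1) (eta_inv \<mu>\<^sub>1)"
      using m.eta_inv_is_local_inverse m1.eta_inv_is_local_inverse \<mu>_star star
      by (auto simp: prob_circle_star_def)
    have "\<forall>\<^sub>F z in nhds 0. z * eta_inv \<mu> z = eta_inv \<mu>\<^sub>1 z * \<Phi> z"
      using conv assms(10) unfolding is_free_mult_conv_def
      by (auto elim: eventually_elim2)
    then have "\<forall>\<^sub>F z in nhds 0. eta \<mu> z * eta_inv \<mu> (eta \<mu> z) = eta_inv \<mu>\<^sub>1 (eta \<mu> z) * \<Phi> (eta \<mu> z)"
      by (rule eventually_compose_filterlim[OF _ \<mu>_lim])
    moreover have "\<forall>\<^sub>F z in nhds 0. eta_inv \<mu> (eta \<mu> z) = z"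
      using inv(1) by (auto simp: is_local_inverse_at_0_def elim: eventually_mono)
    moreover have "\<forall>\<^sub>F z in nhds 0. eta_inv \<mu>\<^sub>1 (eta \<mu>\<^sub>1 (eta \<rho>\<^sub>1 z)) = eta \<rho>\<^sub>1 z"
      using inv(2) by (intro eventually_compose_filterlim[OF _ \<rho>_lim])
        (auto simp: is_local_inverse_at_0_def elim: eventually_mono)
    moreover have "\<forall>\<^sub>F z in nhds 0. z \<in> ball (0 :: complex) 1"
      by (intro eventually_nhds_in_open) auto
    ultimately show ?thesis
    proof eventually_elim
      case (elim z)
      then have z: "norm z < 1" by simp
      define h where "h = eta \<mu> z"
      have h: "h = eta \<mu>\<^sub>1 (eta \<rho>\<^sub>1 z)" using assms(14) elim(4) by (simp add: h_def)
      have \<Phi>_h: "\<Phi> h = \<gamma> * h * exp (u (eta \<rho>\<^sub>1 z))"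
        using assms(8)[of h] m.norm_eta_less[OF z] exponent[OF r.norm_eta_less[OF z]]
        by (simp add: h[symmetric]) (simp add: h_def)
      have eq: "h * z = eta \<rho>\<^sub>1 z * (\<gamma> * h * exp (u (eta \<rho>\<^sub>1 z)))"
        using elim h \<Phi>_h by (simp add: h_def)
      show ?case
      proof (cases "h = 0")
        \<comment> \<open>Division by \<open>h\<close> fails here, but the local inverse fixes 0, so
          \<open>z = 0\<close> and both sides vanish.\<close>
        case True
        then have "z = 0"
          using elim(2) inv(1) by (simp add: h_def is_local_inverse_at_0_def)
        then show ?thesis by simp
      next
        case False
        have "h * (\<gamma> * eta \<rho>\<^sub>1 z * exp (u (eta \<rho>\<^sub>1 z))) = h * z" using eq by (simp only: mult_ac)
        then show ?thesis using False mult_left_cancel by blast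
      qed
    qed
  qed
  \<comment> \<open>Both sides are holomorphic on the disk, so the identity theorem extends the
    equation from a neighbourhood of 0.\<close>
  have inverse: "\<gamma> * eta \<rho>\<^sub>1 z * exp (u (eta \<rho>\<^sub>1 z)) = z" if z: "norm z < 1" for z
  proof -
    obtain S where S: "open S" "0 \<in> S" "\<And>z. z \<in> S \<Longrightarrow> \<gamma> * eta \<rho>\<^sub>1 z * exp (u (eta \<rho>\<^sub>1 z)) = z"
      using near_0 unfolding eventually_nhds by blast
    have "(\<lambda>z. u (eta \<rho>\<^sub>1 z)) holomorphic_on ball 0 1"
      by (rule holomorphic_on_compose_gen[OF r.eta_holomorphic u_holomorphic, unfolded o_def])
         (auto intro: r.norm_eta_less)
    then have hol: "(\<lambda>z. \<gamma> * eta \<rho>\<^sub>1 z * exp (u (eta \<rho>\<^sub>1 z))) holomorphic_on ball 0 1"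
      by (intro holomorphic_intros r.eta_holomorphic)
    show ?thesis
      by (rule analytic_continuation_open[where f = "\<lambda>z. \<gamma> * eta \<rho>\<^sub>1 z * exp (u (eta \<rho>\<^sub>1 z))"
            and g = "\<lambda>z. z" and s = "S \<inter> ball 0 1" and s' = "ball 0 1"])
         (use S z hol in \<open>auto intro!: holomorphic_intros\<close>)
  qed
  interpret subordination \<mu>\<^sub>1 \<rho>\<^sub>1 \<sigma> \<gamma>
    using assms(6) finite_circle_measure_nonzero[OF \<sigma> assms(11)] inverse by unfold_locales
  have arc: "norm \<xi>\<^sub>0 = 1" "\<And>\<xi>. \<xi> \<in> \<Gamma> \<Longrightarrow> norm \<xi> = 1"
    using assms(15) by (auto simp: open_arc_with_endpoint_def)
  obtain A \<delta> where A: "\<delta> > 0"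
    "\<And>\<xi>. norm \<xi> = 1 \<Longrightarrow> norm (\<xi> - \<xi>\<^sub>0) < \<delta> \<Longrightarrow> conv_density \<mu>\<^sub>1 \<rho>\<^sub>1 \<xi> > 0 \<Longrightarrow>
      conv_density \<mu>\<^sub>1 \<rho>\<^sub>1 \<xi> \<le> A * norm (\<xi> - \<xi>\<^sub>0) powr (1 / 3)"
    using conv_density_bound_near_zero[OF arc(1) assms(16) assms(18)] by blast
  have "norm (conv_density \<mu>\<^sub>1 \<rho>\<^sub>1 \<xi> / norm (\<xi> - \<xi>\<^sub>0) powr (1/3)) \<le> A"
    if \<xi>: "\<xi> \<in> \<Gamma> \<inter> ball \<xi>\<^sub>0 \<delta>" for \<xi>
  proof -
    \<comment> \<open>The density vanishes at the endpoint and is positive on the arc, so the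
      denominator is nonzero.\<close>
    have "\<xi> \<noteq> \<xi>\<^sub>0" using \<xi> assms(16) assms(17)[of \<xi>] by auto
    then have "0 < norm (\<xi> - \<xi>\<^sub>0) powr (1/3)" by simp
    moreover have "0 < conv_density \<mu>\<^sub>1 \<rho>\<^sub>1 \<xi>" using assms(17) \<xi> by blast
    moreover have "conv_density \<mu>\<^sub>1 \<rho>\<^sub>1 \<xi> \<le> A * norm (\<xi> - \<xi>\<^sub>0) powr (1/3)"
      using \<xi> arc(2) calculation(2) by (intro A(2)) (auto simp: dist_norm norm_minus_commute)
    ultimately show ?thesis by (simp add: pos_divide_le_eq)
  qed
  then have "bounded ((\<lambda>\<xi>. conv_density \<mu>\<^sub>1 \<rho>\<^sub>1 \<xi> / norm (\<xi> - \<xi>\<^sub>0) powr (1/3)) ` (\<Gamma> \<inter> ball \<xi>\<^sub>0 \<delta>))"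
    unfolding bounded_iff by blast
  then show ?thesis using A(1) by blast
qed

end
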